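(* Let $\mathbb X=\{X_Q\}_{Q\subset\mathbb R^n}$ be a family of quasi-Banach function spaces, $X_Q$ over $(Q,dx)$ for each cube $Q$, normalized in the sense that $c_0\le\|\chi_Q\|_{X_Q}\le C_0$ for all cubes $Q$ with constants $0<c_0\le C_0<\infty$. Let $\eta_0\in(0,1)$ be the sparsity parameter of the sparse domination principle for local $BMO$ oscillation (see the context). Assume that there exists $0<\lambda<1/2$ such that $\Lambda_{\mathbb X}(\lambda)>0$, and assume that $T_{\mathbb X}(\eta_0)<\infty$. Then $$BMO_{\mathbb X}^{*}\cap L^1_{\mathrm{loc}}(\mathbb R^n)\hookrightarrow BMO\hookrightarrow BMO_{\mathbb X}.$$ Moreover, for every $f\in BMO_{\mathbb X}$, $$\|f\|_{BMO_{\mathbb X}^{*}}\le\|f\|_{BMO_{\mathbb X}}.$$ Consequently, $$BMO=BMO_{\mathbb X}=BMO_{\mathbb X}^{*}\cap L^1_{\mathrm{loc}}(\mathbb R^n)$$ with equivalence of seminorms.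
   Context: Cubes in $\mathbb R^n$ have sides parallel to the coordinate axes; functions are real-valued and measurable; $\langle f\rangle_Q=\frac1{|Q|}\int_Q f$. A quasi-Banach function space over a measure space $\Omega$ is a quasi-normed lattice $X\subset L^0(\Omega)$ such that: (1) if $|f|\le|g|$ a.e. and $g\in X$, then $f\in X$ and $\|f\|_X\le\|g\|_X$; (2) $\|f+g\|_X\le C_X(\|f\|_X+\|g\|_X)$ for some $C_X\ge1$; (3) (Fatou) if $0\le f_j\uparrow f$ a.e. and $\sup_j\|f_j\|_X<\infty$, then $f\in X$ and $\|f\|_X=\sup_j\|f_j\|_X$. The expression $\|g\chi_Q\|_{X_Q}$ denotes the $X_Q$-quasi-norm of the restriction of $g$ to $Q$ (value $+\infty$ if it is not in $X_Q$). For $0<t<1$, $\Lambda_{\mathbb X}(t):=\inf_Q\inf_{E\subset Q,\ |E|\ge t|Q|}\|\chi_E\|_{X_Q}/\|\chi_Q\|_{X_Q}$. $\mathcal D(Q)$ is the collection of dyadic subcubes of $Q$, obtained by repeatedly subdividing $Q$ into $2^n$ congruent subcubes. For $\mathcal S\subset\mathcal D(Q)$ and $P\in\mathcal S$, $\operatorname{ch}_{\mathcal S}(P)$ is the collection of maximal cubes $R\in\mathcal S$ with $R\subsetneq P$. For $0<\eta<1$, $\mathcal S$ is $\eta$-sparse if $\sum_{R\in\operatorname{ch}_{\mathcal S}(P)}|R|\le(1-\eta)|P|$ for every $P\in\mathcal S$. Set $T_{\mathbb X}(\eta):=\sup_Q\sup\{\|\sum_{P\in\mathcal S}\chi_P\|_{X_Q}:\mathcal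 S\subset\mathcal D(Q)\ \eta\text{-sparse}\}$. $\|f\|_{BMO}:=\sup_Q\frac1{|Q|}\int_Q|f-\langle f\rangle_Q|\,dx$ and $\|f\|_{BMO_{\mathbb X}}:=\sup_Q\|(f-\langle f\rangle_Q)\chi_Q\|_{X_Q}$ for $f\in L^1_{\mathrm{loc}}(\mathbb R^n)$; $\|f\|_{BMO_{\mathbb X}^{*}}:=\sup_Q\inf_{c\in\mathbb R}\|(f-c)\chi_Q\|_{X_Q}$ for measurable $f$. The corresponding spaces consist of the functions (locally integrable for the first two) for which these are finite; $BMO_{\mathbb X}^{*}\cap L^1_{\mathrm{loc}}$ carries the seminorm $\|\cdot\|_{BMO_{\mathbb X}^*}$. $A\hookrightarrow B$ denotes continuous embedding (with respect to the seminorms). Sparse domination principle: $\eta_0\in(0,1)$ and $C_n>0$ denote constants depending only on $n$ with the property that for every $f\in BMO(\mathbb R^n)$ and every cube $Q$ there is an $\eta_0$-sparse family $\mathcal S\subset\mathcal D(Q)$ such that $|f(x)-\langle f\rangle_Q|\chi_Q(x)\le C_n\|f\|_{BMO}\sum_{P\in\mathcal S}\chi_P(x)$ for a.e. $x\in Q$ (such constants exist). *)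

theory Defs
  imports "HOL-Analysis.Analysis"
begin

text \<open>Cubes are closed, with the sides parallel to the axes. Everything below is insensitive
  to null sets, so the choice of closed rather than half-open cubes is immaterial.\<close>

definition cube :: "real ^ 'n \<Rightarrow> real \<Rightarrow> (real ^ 'n) set" where
  "cube a l = cbox a (\<chi> i. a $ i + l)"

definition cubes :: "(real ^ 'n) set set" where
  "cubes = {cube a l | a l. 0 < l}"

definition average :: "(real ^ 'n \<Rightarrow> real) \<Rightarrow> (real ^ 'n) set \<Rightarrow> real" where
  "average f Q = (LINT x:Q|lebesgue. f x) / measure lebesgue Q"

definition L1_loc :: "(real ^ 'n \<Rightarrow> real) set" where
  "L1_loc = {f \<in> borel_measurable lebesgue. \<forall>K. compact K \<longrightarrow> set_integrable lebesgue K f}"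

record 'a function_space =
  fs_carrier :: "('a \<Rightarrow> real) set"
  fs_qnorm :: "('a \<Rightarrow> real) \<Rightarrow> real"

text \<open>Elements of \<open>L\<^sup>0\<close> are represented by measurable functions rather than by classes modulo
  a.e. equality; \<open>ideal\<close> makes the carrier and the quasi-norm invariant under a.e. equality
  (and, for \<open>M = lebesgue_on Q\<close>, independent of the values outside \<open>Q\<close>).
  Completeness is not an axiom, as it follows from the Fatou property.\<close>

locale quasi_banach_function_space =
  fixes M :: "'a measure" and X :: "'a function_space"
  assumes measurable: "fs_carrier X \<subseteq> borel_measurable M"
    and zero_mem: "(\<lambda>x. 0) \<in> fs_carrier X"
    and add_mem: "f \<in> fs_carrier X \<Longrightarrow> g \<in> fs_carrier X \<Longrightarrow> (\<lambda>x. f x + g x) \<in> fs_carrier X"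
    and scale_mem: "f \<in> fs_carrier X \<Longrightarrow> (\<lambda>x. c * f x) \<in> fs_carrier X"
    and qnorm_nonneg: "f \<in> fs_carrier X \<Longrightarrow> 0 \<le> fs_qnorm X f"
    and qnorm_eq_0: "f \<in> fs_carrier X \<Longrightarrow> fs_qnorm X f = 0 \<longleftrightarrow> (AE x in M. f x = 0)"
    and qnorm_scale: "f \<in> fs_carrier X \<Longrightarrow> fs_qnorm X (\<lambda>x. c * f x) = \<bar>c\<bar> * fs_qnorm X f"
    and ideal: "f \<in> borel_measurable M \<Longrightarrow> g \<in> fs_carrier X \<Longrightarrow> (AE x in M. \<bar>f x\<bar> \<le> \<bar>g x\<bar>)
      \<Longrightarrow> f \<in> fs_carrier X \<and> fs_qnorm X f \<le> fs_qnorm X g"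
    and quasi_triangle: "\<exists>C\<ge>1. \<forall>f\<in>fs_carrier X. \<forall>g\<in>fs_carrier X.
      fs_qnorm X (\<lambda>x. f x + g x) \<le> C * (fs_qnorm X f + fs_qnorm X g)"
    and fatou: "(\<And>j::nat. F j \<in> fs_carrier X) \<Longrightarrow> f \<in> borel_measurable M
      \<Longrightarrow> (AE x in M. (\<forall>j. 0 \<le> F j x) \<and> incseq (\<lambda>j. F j x) \<and> (\<lambda>j. F j x) \<longlonglongrightarrow> f x)
      \<Longrightarrow> bdd_above (range (\<lambda>j. fs_qnorm X (F j)))
      \<Longrightarrow> f \<in> fs_carrier X \<and> fs_qnorm X f = (SUP j. fs_qnorm X (F j))"

text \<open>For \<open>X = X\<^sub>Q\<close> over \<open>lebesgue_on Q\<close>, this is the extended quasi-norm of the restriction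
  of \<open>g\<close> to \<open>Q\<close>.\<close>

definition ext_qnorm :: "'a function_space \<Rightarrow> ('a \<Rightarrow> real) \<Rightarrow> ennreal" where
  "ext_qnorm X g = (if g \<in> fs_carrier X then ennreal (fs_qnorm X g) else \<infinity>)"

definition Lambda_fam :: "((real ^ 'n) set \<Rightarrow> (real ^ 'n) function_space) \<Rightarrow> real \<Rightarrow> ennreal" where
  "Lambda_fam X t = (INF Q\<in>cubes.
     INF E\<in>{E \<in> sets lebesgue. E \<subseteq> Q \<and> measure lebesgue E \<ge> t * measure lebesgue Q}.
       ext_qnorm (X Q) (indicat_real E) / ext_qnorm (X Q) (indicat_real Q))"

inductive_set dyadic :: "(real ^ 'n) set \<Rightarrow> (real ^ 'n) set set" for Q :: "(real ^ 'n) set" where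
  self: "Q \<in> dyadic Q"
| subdivide: "cube a l \<in> dyadic Q \<Longrightarrow> 0 < l \<Longrightarrow> (\<And>i. v $ i \<in> {0, 1})
    \<Longrightarrow> cube (a + (l / 2) *\<^sub>R v) (l / 2) \<in> dyadic Q"

definition ch :: "(real ^ 'n) set set \<Rightarrow> (real ^ 'n) set \<Rightarrow> (real ^ 'n) set set" where
  "ch S P = {R \<in> S. R \<subset> P \<and> \<not> (\<exists>R'\<in>S. R \<subset> R' \<and> R' \<subset> P)}"

definition sparse :: "real \<Rightarrow> (real ^ 'n) set set \<Rightarrow> bool" where
  "sparse \<eta> S \<longleftrightarrow> (\<forall>P\<in>S.
     (\<Sum>\<^sub>\<infinity>R\<in>ch S P. emeasure lebesgue R) \<le> ennreal (1 - \<eta>) * emeasure lebesgue P)"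

definition sparse_sum :: "(real ^ 'n) set set \<Rightarrow> real ^ 'n \<Rightarrow> ennreal" where
  "sparse_sum S x = (\<Sum>\<^sub>\<infinity>P\<in>S. indicator P x)"

text \<open>For an \<open>\<eta>\<close>-sparse family of dyadic subcubes with \<open>\<eta> > 0\<close>, the sum is finite a.e.,
  so that \<^const>\<open>enn2real\<close> alters it only on a null set.\<close>

definition T_fam :: "((real ^ 'n) set \<Rightarrow> (real ^ 'n) function_space) \<Rightarrow> real \<Rightarrow> ennreal" where
  "T_fam X \<eta> = (SUP Q\<in>cubes. SUP S\<in>{S. S \<subseteq> dyadic Q \<and> sparse \<eta> S}.
     ext_qnorm (X Q) (\<lambda>x. enn2real (sparse_sum S x)))"

definition bmo_norm :: "(real ^ 'n \<Rightarrow> real) \<Rightarrow> ennreal" where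
  "bmo_norm f = (SUP Q\<in>cubes. ennreal (average (\<lambda>x. \<bar>f x - average f Q\<bar>) Q))"

definition BMO :: "(real ^ 'n \<Rightarrow> real) set" where
  "BMO = {f \<in> L1_loc. bmo_norm f < \<infinity>}"

definition bmo_X_norm ::
  "((real ^ 'n) set \<Rightarrow> (real ^ 'n) function_space) \<Rightarrow> (real ^ 'n \<Rightarrow> real) \<Rightarrow> ennreal" where
  "bmo_X_norm X f = (SUP Q\<in>cubes. ext_qnorm (X Q) (\<lambda>x. f x - average f Q))"

definition BMO_X ::
  "((real ^ 'n) set \<Rightarrow> (real ^ 'n) function_space) \<Rightarrow> (real ^ 'n \<Rightarrow> real) set" where
  "BMO_X X = {f \<in> L1_loc. bmo_X_norm X f < \<infinity>}"

definition bmo_X_star_norm ::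
  "((real ^ 'n) set \<Rightarrow> (real ^ 'n) function_space) \<Rightarrow> (real ^ 'n \<Rightarrow> real) \<Rightarrow> ennreal" where
  "bmo_X_star_norm X f = (SUP Q\<in>cubes. INF c. ext_qnorm (X Q) (\<lambda>x. f x - c))"

definition BMO_X_star ::
  "((real ^ 'n) set \<Rightarrow> (real ^ 'n) function_space) \<Rightarrow> (real ^ 'n \<Rightarrow> real) set" where
  "BMO_X_star X = {f \<in> borel_measurable lebesgue. bmo_X_star_norm X f < \<infinity>}"

text \<open>The constants of the sparse domination principle depend only on the dimension, that is,
  on the index type.\<close>

definition sparse_domination :: "'n::finite itself \<Rightarrow> real \<Rightarrow> real \<Rightarrow> bool" where
  "sparse_domination _ \<eta> C \<longleftrightarrow> 0 < \<eta> \<and> \<eta> < 1 \<and> 0 < C \<and>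
     (\<forall>f\<in>(BMO :: (real ^ 'n \<Rightarrow> real) set). \<forall>Q\<in>cubes. \<exists>S \<subseteq> dyadic Q. sparse \<eta> S \<and>
       (AE x in lebesgue_on Q.
          ennreal \<bar>f x - average f Q\<bar> \<le> ennreal C * bmo_norm f * sparse_sum S x))"

text \<open>Continuity of the inclusion of \<open>(A, p)\<close> into \<open>(B, q)\<close> is expressed by boundedness, the
  (quasi-)seminorms being homogeneous.\<close>

definition continuously_embedded ::
  "'b set \<Rightarrow> ('b \<Rightarrow> ennreal) \<Rightarrow> 'b set \<Rightarrow> ('b \<Rightarrow> ennreal) \<Rightarrow> bool" where
  "continuously_embedded A p B q \<longleftrightarrow>
     A \<subseteq> B \<and> (\<exists>K::real. 0 \<le> K \<and> (\<forall>f\<in>A. q f \<le> ennreal K * p f))"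

definition equivalent_seminorms_on :: "'b set \<Rightarrow> ('b \<Rightarrow> ennreal) \<Rightarrow> ('b \<Rightarrow> ennreal) \<Rightarrow> bool" where
  "equivalent_seminorms_on A p q \<longleftrightarrow>
     (\<exists>a b::real. 0 < a \<and> 0 < b \<and> (\<forall>f\<in>A. ennreal a * p f \<le> q f \<and> q f \<le> ennreal b * p f))"

end

theory Submission
  imports Defs
begin

text \<open>
  The two inclusions rest on unrelated facts.

  \<^emph>\<open>From the oscillation quasi-norms to BMO.\<close> If \<open>\<parallel>(f - c)\<chi>\<^sub>Q\<parallel> < \<delta>\<close>, then the set
  \<open>E \<subseteq> Q\<close> on which \<open>\<bar>f - c\<bar> > M = \<delta> / (\<Lambda> c\<^sub>0)\<close> satisfies \<open>M \<parallel>\<chi>\<^sub>E\<parallel> < \<delta>\<close>, so that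
  \<open>\<parallel>\<chi>\<^sub>E\<parallel> / \<parallel>\<chi>\<^sub>Q\<parallel> < \<Lambda>\<close>; by definition of \<open>\<Lambda>\<close> the set occupies less than the fraction \<open>t\<close>
  of \<open>Q\<close> (\<open>measure_superlevel_le_Lambda\<close>). This is a bound for the local oscillation in the sense of
  John and Stromberg, and since \<open>t < 1/2\<close> their theorem (\<open>john_stromberg\<close>) turns it into a bound
  for the mean oscillation, linear in \<open>\<delta>\<close>.

  The John-Stromberg theorem is proved by one stopping-time step. Two cubes whose exceptional sets
  together do not fill the smaller cube have nearby centers. Because \<open>2t < 1\<close>, this applies to nested
  cubes of almost equal volume, and a chain of such cubes links a dyadic cube to its parent. Inside \<open>Q\<close>,
  stop at the maximal dyadic cubes at least half filled by the exceptional set of \<open>Q\<close>. Their total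
  measure is at most \<open>2t\<bar>Q\<bar>\<close>, the exceptional set is a.e. contained in their union, and their
  centers differ from that of \<open>Q\<close> by at most a multiple \<open>K\<close> of \<open>M\<close>. Hence, if
  \<open>\<gamma>\<close> is the supremum over all cubes of the mean of \<open>min \<bar>f - c\<^sub>Q\<bar> N\<close>, then \<open>\<gamma> \<le> M + 2t(K + \<gamma>)\<close>. The truncation makes
  \<open>\<gamma>\<close> finite, so that \<open>\<gamma>\<close> can be absorbed, and the resulting bound does not depend on \<open>N\<close>.

  \<^emph>\<open>From BMO to the oscillation quasi-norms.\<close> By sparse domination, \<open>\<bar>f - \<langle>f\<rangle>\<^sub>Q\<bar>\<close> is at most a
  multiple of a sparse sum, whose quasi-norm is controlled by \<open>T\<close>. The comparison of the real-valued
  functions needs the sparse sum to be finite almost everywhere (\<open>AE_finite_sparse\<close>). A point that lies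
  in infinitely many cubes of the family and in one of them, \<open>P\<close>, lies in a child of \<open>P\<close>,
  up to null sets. Passing to the children loses the factor \<open>1 - \<eta>\<close> each time,
  so these points form a null set.
\<close>

section \<open>Half-open cubes and dyadic grids\<close>

text \<open>Half-open cubes, unlike closed ones, make the dyadic cubes of one generation disjoint.\<close>
definition hcube :: "real ^ 'n \<Rightarrow> real \<Rightarrow> (real ^ 'n) set" where
  "hcube a l = {x. \<forall>i. a $ i \<le> x $ i \<and> x $ i < a $ i + l}"

lemma mem_cube: "x \<in> cube a l \<longleftrightarrow> (\<forall>i. a $ i \<le> x $ i \<and> x $ i \<le> a $ i + l)"
  by (simp add: cube_def mem_box_cart)

lemma hcube_subset_cube: "hcube a l \<subseteq> cube a l"
  by (auto simp: hcube_def mem_cube less_imp_le)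

lemma lmeasurable_cube [simp]: "cube a l \<in> lmeasurable"
  by (simp add: cube_def)

lemma sets_cube [simp, measurable]: "cube a l \<in> sets lebesgue"
  by (simp add: cube_def)

lemma measure_cube:
  fixes a :: "real ^ 'n"
  assumes "0 < l"
  shows "measure lebesgue (cube a l) = l ^ CARD('n)"
proof -
  have "cbox a (\<chi> i. a $ i + l) \<noteq> {}"
    using assms by (simp add: interval_ne_empty_cart less_imp_le)
  then show ?thesis
    using content_cbox_cart[of a "\<chi> i. a $ i + l"] by (simp add: cube_def)
qed

lemma hcube_eq_Diff: "hcube a l = cube a l - (\<Union>i. {x. x $ i = a $ i + l})"
  by (auto simp: hcube_def mem_cube less_le)

lemma negligible_cube_Diff_hcube: "negligible (cube a l - hcube a l)"
proof -
  have "negligible (\<Union>i. {x. x $ i = a $ i + l})"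
  proof (intro negligible_Union; clarsimp)
    fix i
    show "negligible {x. x $ i = a $ i + l}"
      using negligible_standard_hyperplane[of "axis i (1::real)" "a $ i + l"]
      by (simp add: inner_axis)
  qed
  then show ?thesis
    by (rule negligible_subset) (auto simp: hcube_eq_Diff)
qed

lemma sets_hcube [simp, measurable]: "hcube a l \<in> sets lebesgue"
proof -
  have "hcube a l = cube a l - (cube a l - hcube a l)"
    using hcube_subset_cube by blast
  then show ?thesis
    using sets.Diff[OF sets_cube negligible_imp_sets[OF negligible_cube_Diff_hcube]] by metis
qed

lemma lmeasurable_hcube [simp]: "hcube a l \<in> lmeasurable"
  using fmeasurableI2[OF lmeasurable_cube hcube_subset_cube sets_hcube] by blast

lemma measure_hcube:
  fixes a :: "real ^ 'n"
  assumes "0 < l"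
  shows "measure lebesgue (hcube a l) = l ^ CARD('n)"
proof -
  have "measure lebesgue (cube a l - (cube a l - hcube a l)) = measure lebesgue (cube a l)"
    by (intro measure_Diff_null_set sets_cube)
       (use negligible_cube_Diff_hcube negligible_iff_null_sets in blast)
  moreover have "cube a l - (cube a l - hcube a l) = hcube a l"
    using hcube_subset_cube by blast
  ultimately show ?thesis
    using measure_cube[OF assms] by metis
qed

lemma emeasure_hcube:
  fixes a :: "real ^ 'n"
  assumes "0 < l"
  shows "emeasure lebesgue (hcube a l) = ennreal (l ^ CARD('n))"
  using emeasure_eq_measure2[OF lmeasurable_hcube[of a l]] by (simp only: measure_hcube[OF assms])

text \<open>The least corner of the dyadic cube of generation \<open>k\<close> that contains \<open>x\<close>. Indexing dyadic
  cubes by their points rather than by lattice vectors makes the ancestors of a cube explicit: they are the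
  cells of the earlier generations at the same point.\<close>
definition grid_corner :: "real ^ 'n \<Rightarrow> real \<Rightarrow> nat \<Rightarrow> real ^ 'n \<Rightarrow> real ^ 'n" where
  "grid_corner a l k x = (\<chi> i. a $ i + l / 2 ^ k * of_int \<lfloor>(x $ i - a $ i) * 2 ^ k / l\<rfloor>)"

definition grid_cell :: "real ^ 'n \<Rightarrow> real \<Rightarrow> nat \<Rightarrow> real ^ 'n \<Rightarrow> (real ^ 'n) set" where
  "grid_cell a l k x = hcube (grid_corner a l k x) (l / 2 ^ k)"

text \<open>Membership is an equality of integer vectors, so the cells of each generation are the classes
  of an equivalence relation. Nesting and disjointness follow from this description.\<close>
lemma mem_grid_cell:
  assumes "0 < l"
  shows "y \<in> grid_cell a l k x \<longleftrightarrow>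
    (\<forall>i. \<lfloor>(y $ i - a $ i) * 2 ^ k / l\<rfloor> = \<lfloor>(x $ i - a $ i) * 2 ^ k / l\<rfloor>)"
proof -
  have *: "u + l / 2 ^ k * of_int F \<le> v \<and> v < u + l / 2 ^ k * of_int F + l / 2 ^ k
      \<longleftrightarrow> \<lfloor>(v - u) * 2 ^ k / l\<rfloor> = F" for u v :: real and F
    using assms by (simp add: floor_eq_iff field_simps)
  show ?thesis
    unfolding grid_cell_def hcube_def grid_corner_def mem_Collect_eq vec_lambda_beta * ..
qed

lemma grid_cell_self: "0 < l \<Longrightarrow> x \<in> grid_cell a l k x"
  by (simp add: mem_grid_cell)

lemma grid_cell_eq: "0 < l \<Longrightarrow> y \<in> grid_cell a l k x \<Longrightarrow> grid_cell a l k y = grid_cell a l k x"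
  by (auto simp: mem_grid_cell set_eq_iff)

lemma floor_double_scaled:
  "2 * \<lfloor>u * 2 ^ k / l\<rfloor> \<le> \<lfloor>u * 2 ^ Suc k / (l::real)\<rfloor>"
  "\<lfloor>u * 2 ^ Suc k / l\<rfloor> \<le> 2 * \<lfloor>u * 2 ^ k / l\<rfloor> + 1"
proof -
  have "u * 2 ^ Suc k / l = 2 * (u * 2 ^ k / l)" by simp
  then show "2 * \<lfloor>u * 2 ^ k / l\<rfloor> \<le> \<lfloor>u * 2 ^ Suc k / l\<rfloor>"
    "\<lfloor>u * 2 ^ Suc k / l\<rfloor> \<le> 2 * \<lfloor>u * 2 ^ k / l\<rfloor> + 1"
    by linarith+
qed

lemma grid_cell_Suc: 
  assumes "0 < l"
  shows "grid_cell a l (Suc k) x \<subseteq> grid_cell a l k x"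
proof
  fix y assume "y \<in> grid_cell a l (Suc k) x"
  then have eq: "\<lfloor>(y $ i - a $ i) * 2 ^ Suc k / l\<rfloor> = \<lfloor>(x $ i - a $ i) * 2 ^ Suc k / l\<rfloor>" for i
    using mem_grid_cell[OF assms] by blast
  have "\<lfloor>(y $ i - a $ i) * 2 ^ k / l\<rfloor> = \<lfloor>(x $ i - a $ i) * 2 ^ k / l\<rfloor>" for i
    using floor_double_scaled[of "y $ i - a $ i" k l] floor_double_scaled[of "x $ i - a $ i" k l]
      eq[of i] by linarith
  then show "y \<in> grid_cell a l k x"
    using mem_grid_cell[OF assms] by blast
qed

lemma grid_cell_antimono: "0 < l \<Longrightarrow> j \<le> k \<Longrightarrow> grid_cell a l k x \<subseteq> grid_cell a l j x"
  by (rule lift_Suc_antimono_le[of "\<lambda>k. grid_cell a l k x"]) (auto dest: grid_cell_Suc[THEN subsetD])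

lemma grid_cell_0:
  assumes "x \<in> hcube a l" "0 < l"
  shows "grid_cell a l 0 x = hcube a l"
proof -
  have "\<lfloor>(x $ i - a $ i) / l\<rfloor> = 0" for i
    using assms by (simp add: floor_eq_iff hcube_def field_simps)
  then have "grid_corner a l 0 x = a"
    by (simp add: grid_corner_def vec_eq_iff)
  then show ?thesis by (simp add: grid_cell_def)
qed

lemma grid_cell_subset: "0 < l \<Longrightarrow> x \<in> hcube a l \<Longrightarrow> grid_cell a l k x \<subseteq> hcube a l"
  using grid_cell_antimono[of l 0 k a x] grid_cell_0[of x a l] by simp

text \<open>Compares the closures of the cells, to which the description by integer vectors does not apply.\<close>
lemma grid_corner_nested:
  assumes "0 < l"
  shows "grid_corner a l k x $ i \<le> grid_corner a l (Suc k) x $ i"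
    and "grid_corner a l (Suc k) x $ i + l / 2 ^ Suc k \<le> grid_corner a l k x $ i + l / 2 ^ k"
proof -
  let ?F = "\<lfloor>(x $ i - a $ i) * 2 ^ k / l\<rfloor>" and ?G = "\<lfloor>(x $ i - a $ i) * 2 ^ Suc k / l\<rfloor>"
  have d: "0 < l / 2 ^ Suc k" "l / 2 ^ k = l / 2 ^ Suc k * 2" using assms by auto
  have "2 * real_of_int ?F \<le> ?G" "?G \<le> 2 * real_of_int ?F + 1"
    using floor_double_scaled[of "x $ i - a $ i" k l] by linarith+
  then have "l / 2 ^ Suc k * (2 * real_of_int ?F) \<le> l / 2 ^ Suc k * ?G \<and>
    l / 2 ^ Suc k * ?G \<le> l / 2 ^ Suc k * (2 * real_of_int ?F + 1)"
    using d(1) by (simp only: mult_le_cancel_left_pos simp_thms)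
  then show "grid_corner a l k x $ i \<le> grid_corner a l (Suc k) x $ i"
    "grid_corner a l (Suc k) x $ i + l / 2 ^ Suc k \<le> grid_corner a l k x $ i + l / 2 ^ k"
    unfolding grid_corner_def d(2) by (simp_all add: algebra_simps)
qed

lemma grid_cell_small:
  fixes x :: "real ^ 'n"
  assumes "open U" "x \<in> U" "0 < l"
  obtains k where "grid_cell a l k x \<subseteq> U"
proof -
  obtain e where e: "e > 0" "ball x e \<subseteq> U"
    using assms openE by blast
  have "(\<lambda>k. real CARD('n) * (l * inverse (2 ^ k))) \<longlonglongrightarrow> real CARD('n) * (l * 0)"
    by (intro tendsto_intros LIMSEQ_inverse_realpow_zero) simp
  then have "\<forall>\<^sub>F k in sequentially. real CARD('n) * (l * inverse (2 ^ k)) < e"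
    by (rule order_tendstoD(2)) (use e(1) in simp)
  then obtain k where k: "real CARD('n) * (l / 2 ^ k) < e"
    by (auto simp: eventually_sequentially divide_inverse)
  have "y \<in> ball x e" if y: "y \<in> grid_cell a l k x" for y
  proof -
    have "\<bar>(x - y) $ i\<bar> \<le> l / 2 ^ k" for i
      using y grid_cell_self[OF assms(3), of x a k] unfolding grid_cell_def hcube_def
      by (auto simp: abs_le_iff algebra_simps dest!: spec[of _ i])
    then have "(\<Sum>i\<in>UNIV. \<bar>(x - y) $ i\<bar>) \<le> (\<Sum>i\<in>(UNIV::'n set). l / 2 ^ k)"
      by (intro sum_mono)
    then have "norm (x - y) \<le> real CARD('n) * (l / 2 ^ k)"
      using norm_le_l1_cart[of "x - y"] by simp
    then show ?thesis using k by (simp add: dist_norm)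
  qed
  then show ?thesis using e(2) that by blast
qed

lemma countable_grid_cells:
  fixes a :: "real ^ 'n"
  shows "countable (range (\<lambda>(k, x). grid_cell a l k x))"
proof -
  have "range (\<lambda>(k, x). grid_cell a l k x) \<subseteq>
     range (\<lambda>(k, v :: int ^ 'n). hcube (\<chi> i. a $ i + l / 2 ^ k * of_int (v $ i)) (l / 2 ^ k))"
    (is "_ \<subseteq> range ?g")
  proof clarify
    fix k x
    have "grid_cell a l k x = ?g (k, \<chi> i. \<lfloor>(x $ i - a $ i) * 2 ^ k / l\<rfloor>)"
      by (simp add: grid_cell_def grid_corner_def)
    then show "grid_cell a l k x \<in> range ?g" by blast
  qed
  then show ?thesis
    by (rule countable_subset) simp
qed

text \<open>The maximal cells with property \<open>P\<close>: going down from the whole cube towards a point \<open>x\<close>,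
  one stops at the first cell that satisfies \<open>P\<close>.\<close>
definition stopping_cells ::
  "real ^ 'n \<Rightarrow> real \<Rightarrow> ((real ^ 'n) set \<Rightarrow> bool) \<Rightarrow> (real ^ 'n) set set" where
  "stopping_cells a l P = {grid_cell a l k x | k x.
     x \<in> hcube a l \<and> P (grid_cell a l k x) \<and> (\<forall>j<k. \<not> P (grid_cell a l j x))}"

lemma countable_stopping_cells: "countable (stopping_cells a l P)"
  by (rule countable_subset[OF _ countable_grid_cells[of a l]]) (auto simp: stopping_cells_def)

lemma sets_stopping_cells: "stopping_cells a l P \<subseteq> sets lebesgue"
  by (auto simp: stopping_cells_def grid_cell_def)

lemma Union_stopping_cells:
  assumes "0 < l"
  shows "\<Union>(stopping_cells a l P) = {x \<in> hcube a l. \<exists>k. P (grid_cell a l k x)}"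
proof (intro set_eqI iffI)
  fix z assume "z \<in> \<Union>(stopping_cells a l P)"
  then obtain k x where x: "x \<in> hcube a l" "P (grid_cell a l k x)" "z \<in> grid_cell a l k x"
    by (auto simp: stopping_cells_def)
  then show "z \<in> {x \<in> hcube a l. \<exists>k. P (grid_cell a l k x)}"
    using grid_cell_subset[OF assms x(1), of k] grid_cell_eq[OF assms x(3)]
    by (metis (mono_tags, lifting) mem_Collect_eq subsetD)
next
  fix x assume "x \<in> {x \<in> hcube a l. \<exists>k. P (grid_cell a l k x)}"
  then have x: "x \<in> hcube a l" "\<exists>k. P (grid_cell a l k x)" by auto
  define k where "k = (LEAST k. P (grid_cell a l k x))"
  have "P (grid_cell a l k x)"
    unfolding k_def by (rule LeastI_ex[OF x(2)])
  moreover have "\<forall>j<k. \<not> P (grid_cell a l j x)"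
    unfolding k_def using not_less_Least by blast
  ultimately show "x \<in> \<Union>(stopping_cells a l P)"
    using x(1) grid_cell_self[OF assms, of x a k] unfolding stopping_cells_def
    by (intro UnionI[of "grid_cell a l k x"] CollectI exI[of _ k] exI[of _ x]) auto
qed

text \<open>At a common point \<open>z\<close>, both cells are cells of \<open>z\<close>, of the first generation at which \<open>P\<close>
  holds along \<open>z\<close>.\<close>
lemma disjoint_stopping_cells:
  assumes "0 < l"
  shows "disjoint (stopping_cells a l P)"
proof (rule disjointI)
  fix V W assume V: "V \<in> stopping_cells a l P" and W: "W \<in> stopping_cells a l P" and "V \<noteq> W"
  show "V \<inter> W = {}"
  proof (rule ccontr)
    assume "V \<inter> W \<noteq> {}"
    then obtain z where z: "z \<in> V" "z \<in> W" by blast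
    have *: "\<exists>k. V' = grid_cell a l k z \<and> P V' \<and> (\<forall>j<k. \<not> P (grid_cell a l j z))"
      if V': "V' \<in> stopping_cells a l P" "z \<in> V'" for V'
    proof -
      obtain k x where x: "V' = grid_cell a l k x" "P V'" "\<forall>j<k. \<not> P (grid_cell a l j x)"
        using V'(1) unfolding stopping_cells_def by blast
      have "grid_cell a l j z = grid_cell a l j x" if "j \<le> k" for j
        using V'(2) x(1) grid_cell_antimono[OF assms that, of a x] grid_cell_eq[OF assms, of z a j x]
        by blast
      then show ?thesis using x by (intro exI[of _ k]) simp
    qed
    obtain j where j: "V = grid_cell a l j z" "P V" "\<forall>i<j. \<not> P (grid_cell a l i z)"
      using *[OF V z(1)] by blast
    obtain k where k: "W = grid_cell a l k z" "P W" "\<forall>i<k. \<not> P (grid_cell a l i z)"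
      using *[OF W z(2)] by blast
    have "j = k"
      using j k by (cases j k rule: linorder_cases) auto
    with j k \<open>V \<noteq> W\<close> show False by simp
  qed
qed

text \<open>All comparisons on the stopping cells are instances of this one, the measures being Lebesgue
  measure, its restriction to a set, or the measure with density \<open>\<bar>f - c\<bar>\<close> truncated.\<close>
lemma emeasure_Union_le:
  assumes "countable F" "disjoint F" "F \<subseteq> sets M" "sets N = sets M"
    and le: "\<And>W. W \<in> F \<Longrightarrow> emeasure N W \<le> C * emeasure M W"
  shows "emeasure N (\<Union>F) \<le> C * emeasure M (\<Union>F)"
proof -
  have d: "disjoint_family_on (\<lambda>W. W) F"
    using assms(2) by (auto simp: disjoint_family_on_def disjoint_def)
  have "emeasure N (\<Union>((\<lambda>W. W) ` F)) = (\<integral>\<^sup>+W. emeasure N W \<partial>count_space F)"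
    using assms by (intro emeasure_UN_countable d) auto
  also have "\<dots> \<le> (\<integral>\<^sup>+W. C * emeasure M W \<partial>count_space F)"
    using le by (intro nn_integral_mono) auto
  also have "\<dots> = C * (\<integral>\<^sup>+W. emeasure M W \<partial>count_space F)"
    by (intro nn_integral_cmult) auto
  also have "(\<integral>\<^sup>+W. emeasure M W \<partial>count_space F) = emeasure M (\<Union>((\<lambda>W. W) ` F))"
    using assms by (intro emeasure_UN_countable[symmetric] d) auto
  finally show ?thesis by simp
qed

lemma emeasure_Int_eq_density:
  "E \<in> sets M \<Longrightarrow> W \<in> sets M \<Longrightarrow> emeasure (density M (indicator E)) W = emeasure M (E \<inter> W)"
  by (simp only: emeasure_density borel_measurable_indicator indicator_inter_arith[symmetric]
      nn_integral_indicator sets.Int)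

text \<open>A weak form of the Lebesgue density theorem, for dyadic cells and a fixed \<open>s < 1\<close>. Cover the
  set \<open>A\<close> in question by an open \<open>T\<close> only slightly larger, and \<open>T\<close> economically by disjoint cells
  that meet \<open>A\<close>. In each of them \<open>A\<close> has density at most \<open>s\<close>, so
  \<open>\<bar>A\<bar> \<le> s\<bar>T\<bar>\<close>, which is absurd for \<open>\<bar>T\<bar>\<close> close to \<open>\<bar>A\<bar> > 0\<close>.\<close>
lemma null_sets_low_density:
  fixes a :: "real ^ 'n" and s :: real
  assumes l: "0 < l" and E: "E \<in> sets lebesgue" and s: "0 \<le> s" "s < 1"
  shows "{x \<in> hcube a l \<inter> E. \<forall>k. emeasure lebesgue (E \<inter> grid_cell a l k x)
            \<le> ennreal s * emeasure lebesgue (grid_cell a l k x)} \<in> null_sets lebesgue"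
    (is "?A \<in> _")
proof -
  define A where "A = ?A"
  have "A = hcube a l \<inter> E - \<Union>(stopping_cells a l
      (\<lambda>W. \<not> emeasure lebesgue (E \<inter> W) \<le> ennreal s * emeasure lebesgue W))"
    by (auto simp: A_def Union_stopping_cells[OF l])
  moreover have "\<Union>(stopping_cells a l P) \<in> sets lebesgue" for P
    by (rule sets.countable_Union[OF countable_stopping_cells sets_stopping_cells])
  ultimately have A: "A \<in> sets lebesgue"
    using E by (simp only: sets.Diff sets.Int sets_hcube)
  have Alm: "A \<in> lmeasurable"
    using A by (intro fmeasurableI2[OF lmeasurable_hcube[of a l]]) (auto simp: A_def)
  define m where "m = measure lebesgue A"
  have "m = 0"
  proof (rule ccontr)
    assume "m \<noteq> 0"
    then have m: "m > 0" by (simp add: m_def less_le)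
    \<comment> \<open>With this excess, \<open>s\<bar>T\<bar> = m - m(1 - s)\<^sup>2 < m\<close> in the worst case.\<close>
    obtain T where T: "open T" "A \<subseteq> T" "T - A \<in> lmeasurable"
        "emeasure lebesgue (T - A) < ennreal ((1 - s) * m)"
      using sets_lebesgue_outer_open[OF A, of "(1 - s) * m"] m s by auto
    define F where "F = stopping_cells a l (\<lambda>W. W \<subseteq> T \<and> W \<inter> A \<noteq> {})"
    have FT: "\<Union>F \<subseteq> T"
      by (auto simp: F_def stopping_cells_def)
    have AF: "A \<subseteq> E \<inter> \<Union>F"
    proof
      fix x assume x: "x \<in> A"
      then obtain k where "grid_cell a l k x \<subseteq> T"
        using grid_cell_small[OF T(1) _ l, of x a] T(2) by blast
      then show "x \<in> E \<inter> \<Union>F"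
        using x grid_cell_self[OF l, of x a k]
        by (auto simp: F_def Union_stopping_cells[OF l] A_def)
    qed
    have F: "countable F" "F \<subseteq> sets lebesgue" "disjoint F"
      by (auto simp: F_def countable_stopping_cells disjoint_stopping_cells[OF l]
          sets_stopping_cells[THEN subsetD])
    have UF: "\<Union>F \<in> sets lebesgue"
      by (rule sets.countable_Union[OF F(1,2)])
    have "emeasure lebesgue A \<le> emeasure lebesgue (E \<inter> \<Union>F)"
      using AF E UF by (intro emeasure_mono) auto
    also have "\<dots> = emeasure (density lebesgue (indicator E)) (\<Union>F)"
      using E UF by (simp add: emeasure_Int_eq_density)
    also have "\<dots> \<le> ennreal s * emeasure lebesgue (\<Union>F)"
    proof (rule emeasure_Union_le[OF F(1) F(3) F(2)])
      fix W assume W: "W \<in> F"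
      then obtain k x where x: "W = grid_cell a l k x" "W \<inter> A \<noteq> {}"
        by (auto simp: F_def stopping_cells_def)
      then obtain y where "y \<in> W" "y \<in> A" by blast
      then have "emeasure lebesgue (E \<inter> W) \<le> ennreal s * emeasure lebesgue W"
        using x(1) grid_cell_eq[OF l, of y a k x] unfolding A_def by (metis (no_types, lifting) mem_Collect_eq)
      then show "emeasure (density lebesgue (indicator E)) W \<le> ennreal s * emeasure lebesgue W"
        using W F(2) E by (subst emeasure_Int_eq_density) auto
    qed simp
    also have "\<dots> \<le> ennreal s * emeasure lebesgue (A \<union> (T - A))"
      using FT A T(1) by (intro mult_left_mono emeasure_mono) auto
    also have "\<dots> \<le> ennreal s * (emeasure lebesgue A + emeasure lebesgue (T - A))"
      using A T(3) by (intro mult_left_mono emeasure_subadditive) auto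
    also have "\<dots> \<le> ennreal s * (ennreal m + ennreal ((1 - s) * m))"
      using T(4) emeasure_eq_measure2[OF Alm] m_def by (intro mult_left_mono add_mono) auto
    also have "\<dots> = ennreal (s * (m + (1 - s) * m))"
      using s m by (simp only: ennreal_mult ennreal_plus mult_nonneg_nonneg less_imp_le diff_ge_0_iff_ge add_nonneg_nonneg)
    finally have "ennreal m \<le> ennreal (s * (m + (1 - s) * m))"
      by (simp only: emeasure_eq_measure2[OF Alm] m_def)
    then have "m \<le> s * (m + (1 - s) * m)"
      using s m by simp
    moreover have "m - s * (m + (1 - s) * m) = m * (1 - s)\<^sup>2"
      by (simp add: algebra_simps power2_eq_square)
    moreover have "m * (1 - s)\<^sup>2 > 0"
      using s m by simp
    ultimately show False by linarith
  qed
  then have "A \<in> null_sets lebesgue"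
    using A emeasure_eq_measure2[OF Alm] by (simp add: m_def null_sets_def)
  then show ?thesis unfolding A_def .
qed

section \<open>The John-Stromberg theorem\<close>

lemma exists_point_outside:
  assumes "A \<in> lmeasurable" "B \<in> lmeasurable" "H \<in> lmeasurable"
    and "measure lebesgue A + measure lebesgue B < measure lebesgue H"
  obtains x where "x \<in> H" "x \<notin> A" "x \<notin> B"
proof -
  have "\<not> H \<subseteq> A \<union> B"
  proof
    assume "H \<subseteq> A \<union> B"
    then have "measure lebesgue H \<le> measure lebesgue (A \<union> B)"
      using assms by (intro measure_mono_fmeasurable) auto
    also have "\<dots> \<le> measure lebesgue A + measure lebesgue B"
      using assms by (intro measure_Un_le) auto
    finally show False using assms(4) by simp
  qed
  then show thesis using that by blast
qed

lemma lmeasurable_superlevel: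
  fixes f :: "'a::euclidean_space \<Rightarrow> real"
  assumes "f \<in> borel_measurable lebesgue" "S \<in> lmeasurable"
  shows "{x \<in> S. M < \<bar>f x - c\<bar>} \<in> lmeasurable"
proof -
  have "{x. M < \<bar>f x - c\<bar>} \<in> sets lebesgue"
    using borel_measurable_less[of "\<lambda>x. M" lebesgue "\<lambda>x. \<bar>f x - c\<bar>"] assms(1) by simp
  then have "S \<inter> {x. M < \<bar>f x - c\<bar>} \<in> lmeasurable"
    by (rule fmeasurable_Int_fmeasurable[OF assms(2)])
  then show ?thesis by (simp add: Int_def)
qed

text \<open>The data of a local oscillation bound: every cube has a center \<open>c\<close> from which \<open>f\<close> deviates by more
  than \<open>M\<close> on at most a fraction \<open>t\<close> of the cube.\<close>
locale local_centers =
  fixes f :: "real ^ 'n \<Rightarrow> real" and c :: "real ^ 'n \<Rightarrow> real \<Rightarrow> real" and M t :: real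
  assumes f: "f \<in> borel_measurable lebesgue"
    and M: "0 \<le> M"
    and t: "0 \<le> t" "t < 1 / 2"
    and bad: "\<And>a l. 0 < l \<Longrightarrow>
      measure lebesgue {x \<in> cube a l. M < \<bar>f x - c a l\<bar>} \<le> t * l ^ CARD('n)"
begin

text \<open>Some point of the smaller cube is exceptional for neither of the two.\<close>
lemma nested_centers:
  assumes "0 < l" "cube a l \<subseteq> cube a' l'" "0 < l'"
    and "t * l ^ CARD('n) + t * l' ^ CARD('n) < l ^ CARD('n)"
  shows "\<bar>c a l - c a' l'\<bar> \<le> 2 * M"
proof -
  obtain x where "x \<in> cube a l" "x \<notin> {x \<in> cube a l. M < \<bar>f x - c a l\<bar>}"
      "x \<notin> {x \<in> cube a' l'. M < \<bar>f x - c a' l'\<bar>}"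
  proof (rule exists_point_outside)
    show "measure lebesgue {x \<in> cube a l. M < \<bar>f x - c a l\<bar>} +
      measure lebesgue {x \<in> cube a' l'. M < \<bar>f x - c a' l'\<bar>} < measure lebesgue (cube a l)"
      using bad[OF assms(1), of a] bad[OF assms(3), of a'] assms(4)
      by (simp add: measure_cube[OF assms(1)])
  qed (auto intro: lmeasurable_superlevel f)
  then have "\<bar>f x - c a l\<bar> \<le> M" "\<bar>f x - c a' l'\<bar> \<le> M"
    using assms(2) by auto
  then show ?thesis by linarith
qed

text \<open>A cube and its double are too different in volume for a direct comparison when \<open>t\<close> is near \<open>1/2\<close>.
  Interpolate linearly between them: consecutive cubes have side ratio at most \<open>1 + 1/k\<close>,
  which the choice of \<open>k\<close> allows.\<close>
lemma parent_centers:
  assumes l: "0 < l" and a: "\<And>i. a' $ i \<le> a $ i" "\<And>i. a $ i + l \<le> a' $ i + 2 * l"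
    and k: "0 < k" "t * (1 + (1 + 1 / real k) ^ CARD('n)) < 1"
  shows "\<bar>c a l - c a' (2 * l)\<bar> \<le> 2 * real k * M"
proof -
  define b where "b j = a + (real j / real k) *\<^sub>R (a' - a)" for j
  define r where "r j = l * (1 + real j / real k)" for j
  have r: "l \<le> r j" "r (Suc j) = r j + l / k" for j
    using l by (auto simp: r_def add_divide_distrib distrib_left)
  have "\<bar>c a l - c (b j) (r j)\<bar> \<le> 2 * real j * M" for j
  proof (induction j)
    case 0
    then show ?case by (simp add: b_def r_def)
  next
    case (Suc j)
    have "r (Suc j) \<le> r j * (1 + 1 / k)"
      using r[of j] k(1) l by (simp add: field_simps)
    then have "r (Suc j) ^ CARD('n) \<le> r j ^ CARD('n) * (1 + 1 / k) ^ CARD('n)"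
      unfolding power_mult_distrib[symmetric] using r(1)[of "Suc j"] l by (intro power_mono) auto
    then have "t * r j ^ CARD('n) + t * r (Suc j) ^ CARD('n) \<le>
        t * r j ^ CARD('n) + t * (r j ^ CARD('n) * (1 + 1 / k) ^ CARD('n))"
      using t by (intro add_left_mono mult_left_mono) auto
    also have "\<dots> = t * (1 + (1 + 1 / real k) ^ CARD('n)) * r j ^ CARD('n)"
      by (simp add: algebra_simps)
    also have "\<dots> < 1 * r j ^ CARD('n)"
      using k(2) r(1)[of j] l by (intro mult_strict_right_mono) auto
    finally have small: "t * r j ^ CARD('n) + t * r (Suc j) ^ CARD('n) < r j ^ CARD('n)"
      by simp
    have "cube (b j) (r j) \<subseteq> cube (b (Suc j)) (r (Suc j))"
    proof
      fix x assume x: "x \<in> cube (b j) (r j)"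
      have "b (Suc j) $ i = b j $ i - (a $ i - a' $ i) / k" for i
        using k(1) by (simp add: b_def field_simps)
      moreover have "0 \<le> (a $ i - a' $ i) / k" "(a $ i - a' $ i) / k \<le> l / k" for i
        using a(1)[of i] a(2)[of i] k(1) by (auto intro!: divide_right_mono)
      ultimately show "x \<in> cube (b (Suc j)) (r (Suc j))"
        using x unfolding mem_cube r(2) by (smt (verit))
    qed
    then have "\<bar>c (b j) (r j) - c (b (Suc j)) (r (Suc j))\<bar> \<le> 2 * M"
      using r(1)[of j] r(1)[of "Suc j"] l small by (intro nested_centers) auto
    then show ?case
      using Suc by (simp add: algebra_simps)
  qed
  from this[of k] show ?thesis
    using k(1) by (simp add: b_def r_def mult.commute)
qed

definition trunc_osc :: "real \<Rightarrow> real ^ 'n \<Rightarrow> real \<Rightarrow> ennreal" where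
  "trunc_osc N a l = (\<integral>\<^sup>+x\<in>hcube a l. ennreal (min \<bar>f x - c a l\<bar> N) \<partial>lebesgue)"

text \<open>The stopping-time step: a bound \<open>\<gamma>\<close> for the truncated mean oscillation on all cubes yields the
  bound \<open>M + 2t(K + \<gamma>)\<close>, where \<open>K\<close> bounds the jump of the centers from a cube to its stopping cells.\<close>
lemma trunc_osc_step:
  assumes l: "0 < l" and N: "0 \<le> N" and \<gamma>: "0 \<le> \<gamma>"
    and bound: "\<And>b r. 0 < r \<Longrightarrow> trunc_osc N b r \<le> ennreal (\<gamma> * r ^ CARD('n))"
    and k: "0 < k" "t * (1 + (1 + 1 / real k) ^ CARD('n)) < 1"
  shows "trunc_osc N a l \<le>
    ennreal ((M + 2 * t * (2 * (real k + 1) * M + \<gamma>)) * l ^ CARD('n))"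
proof -
  define K where "K = 2 * (real k + 1) * M"
  have K: "0 \<le> K" using M by (simp add: K_def)
  define E where "E = {x \<in> hcube a l. M < \<bar>f x - c a l\<bar>}"
  have Elm: "E \<in> lmeasurable"
    unfolding E_def by (intro lmeasurable_superlevel f) simp
  then have E: "E \<in> sets lebesgue" by auto
  have "measure lebesgue E \<le> measure lebesgue {x \<in> cube a l. M < \<bar>f x - c a l\<bar>}"
    using hcube_subset_cube[of a l] E
    by (intro measure_mono_fmeasurable lmeasurable_superlevel f) (auto simp: E_def)
  then have mE: "emeasure lebesgue E \<le> ennreal (t * l ^ CARD('n))"
    using bad[OF l, of a] by (simp add: emeasure_eq_measure2[OF Elm] ennreal_leI)
  define P where "P W \<longleftrightarrow> \<not> emeasure lebesgue (E \<inter> W) \<le> ennreal (1/2) * emeasure lebesgue W" for W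
  define F where "F = stopping_cells a l P"
  have F: "countable F" "disjoint F" "F \<subseteq> sets lebesgue"
    using countable_stopping_cells[of a l P] disjoint_stopping_cells[OF l, of a P]
      sets_stopping_cells[of a l P] by (simp_all add: F_def)
  have U: "\<Union>F \<in> sets lebesgue"
    by (rule sets.countable_Union[OF F(1,3)])
  have UH: "\<Union>F \<subseteq> hcube a l"
    by (auto simp: F_def Union_stopping_cells[OF l])
  \<comment> \<open>The exceptional set fills at least half of each stopping cell.\<close>
  have "emeasure lebesgue (\<Union>F) \<le> 2 * emeasure (density lebesgue (indicator E)) (\<Union>F)"
  proof (rule emeasure_Union_le)
    fix W assume W: "W \<in> F"
    then have "P W" by (auto simp: F_def stopping_cells_def)
    then have "ennreal (1/2) * emeasure lebesgue W \<le> emeasure lebesgue (E \<inter> W)"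
      by (simp add: P_def)
    then have "2 * (ennreal (1/2) * emeasure lebesgue W) \<le> 2 * emeasure lebesgue (E \<inter> W)"
      by (rule mult_left_mono) simp
    moreover have "2 * (ennreal (1/2) * emeasure lebesgue W) = emeasure lebesgue W"
    proof -
      have "2 * ennreal (1/2) = 1"
        by (simp only: ennreal_numeral[symmetric] ennreal_mult[symmetric]) simp
      then show ?thesis by (simp only: mult.assoc[symmetric] mult_1)
    qed
    ultimately show "emeasure lebesgue W \<le> 2 * emeasure (density lebesgue (indicator E)) W"
      using W F(3) E by (simp add: emeasure_Int_eq_density subset_eq)
  qed (use F in auto)
  also have "emeasure (density lebesgue (indicator E)) (\<Union>F) = emeasure lebesgue (E \<inter> \<Union>F)"
    by (rule emeasure_Int_eq_density[OF E U])
  also have "2 * emeasure lebesgue (E \<inter> \<Union>F) \<le> 2 * ennreal (t * l ^ CARD('n))"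
    using E by (intro mult_left_mono order_trans[OF emeasure_mono mE]) auto
  also have "\<dots> = ennreal (2 * t * l ^ CARD('n))"
    using t l by (simp add: mult.assoc flip: ennreal_numeral ennreal_mult)
  finally have mU: "emeasure lebesgue (\<Union>F) \<le> ennreal (2 * t * l ^ CARD('n))" .

  \<comment> \<open>A stopping cell is not the whole cube. Its parent did not stop, so it contains a point that is
    exceptional neither for the whole cube nor for the parent; this links the two centers.\<close>
  have center: "\<exists>b r. 0 < r \<and> W = hcube b r \<and> \<bar>c a l - c b r\<bar> \<le> K" if "W \<in> F" for W
  proof -
    obtain j x where x: "x \<in> hcube a l" "W = grid_cell a l j x" "P W"
        "\<forall>i<j. \<not> P (grid_cell a l i x)"
      using \<open>W \<in> F\<close> unfolding F_def stopping_cells_def by blast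
    have "\<not> P (hcube a l)"
    proof -
      have "emeasure lebesgue (E \<inter> hcube a l) = emeasure lebesgue E"
        by (rule arg_cong[where f = "emeasure lebesgue"]) (auto simp: E_def)
      also have "\<dots> \<le> ennreal (1/2 * l ^ CARD('n))"
        using t l by (intro order_trans[OF mE] ennreal_leI mult_right_mono) auto
      also have "\<dots> = ennreal (1/2) * emeasure lebesgue (hcube a l)"
        using l by (simp only: emeasure_hcube[OF l]) (intro ennreal_mult; simp)
      finally show ?thesis by (simp add: P_def)
    qed
    then have "j \<noteq> 0"
      using x(2,3) grid_cell_0[OF x(1) l] by metis
    then obtain i where j: "j = Suc i" by (cases j) auto
    define b b' r where "b = grid_corner a l j x" "b' = grid_corner a l i x" "r = l / 2 ^ j"
    have r: "0 < r" "2 * r = l / 2 ^ i" using l by (auto simp: b_b'_r_def(3) j)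
    have V: "grid_cell a l i x = hcube b' (2 * r)"
      by (simp only: grid_cell_def b_b'_r_def(2) r(2))
    have VH: "hcube b' (2 * r) \<subseteq> hcube a l"
      using grid_cell_subset[OF l x(1), of i] by (simp only: V)
    have "\<not> P (hcube b' (2 * r))"
      using x(4) j V by auto
    then have "emeasure lebesgue (E \<inter> hcube b' (2 * r)) \<le>
        ennreal (1/2) * emeasure lebesgue (hcube b' (2 * r))"
      by (simp only: P_def not_not)
    also have "\<dots> = ennreal (1/2 * (2 * r) ^ CARD('n))"
      using r(1) by (simp only: emeasure_hcube ennreal_mult mult_pos_pos zero_less_numeral
          zero_le_power less_imp_le divide_pos_pos zero_less_one)
    finally have mEV: "measure lebesgue (E \<inter> hcube b' (2 * r)) \<le> 1/2 * (2 * r) ^ CARD('n)"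
      using r(1) unfolding measure_def by (subst enn2real_leI) auto
    have EV: "E \<inter> hcube b' (2 * r) \<in> lmeasurable"
      using Elm by (intro fmeasurable_Int_fmeasurable) auto
    have "measure lebesgue {x \<in> cube b' (2 * r). M < \<bar>f x - c b' (2 * r)\<bar>}
        \<le> t * (2 * r) ^ CARD('n)"
      using r(1) by (intro bad) simp
    moreover have "t * (2 * r) ^ CARD('n) < 1/2 * (2 * r) ^ CARD('n)"
      using r(1) t by (intro mult_strict_right_mono) auto
    ultimately have "measure lebesgue (E \<inter> hcube b' (2 * r)) +
        measure lebesgue {x \<in> cube b' (2 * r). M < \<bar>f x - c b' (2 * r)\<bar>}
        < measure lebesgue (hcube b' (2 * r))"
      using mEV measure_hcube[of "2 * r" b'] r(1) by linarith
    then obtain y where y: "y \<in> hcube b' (2 * r)" "y \<notin> E \<inter> hcube b' (2 * r)"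
        "y \<notin> {x \<in> cube b' (2 * r). M < \<bar>f x - c b' (2 * r)\<bar>}"
      by (rule exists_point_outside[OF EV lmeasurable_superlevel[OF f lmeasurable_cube] lmeasurable_hcube])
    then have "\<bar>f y - c a l\<bar> \<le> M" "\<bar>f y - c b' (2 * r)\<bar> \<le> M"
      using VH hcube_subset_cube[of b' "2 * r"] by (auto simp: E_def)
    moreover have "\<bar>c b r - c b' (2 * r)\<bar> \<le> 2 * real k * M"
    proof (rule parent_centers[OF r(1) _ _ k])
      show "b' $ d \<le> b $ d" "b $ d + r \<le> b' $ d + 2 * r" for d
        using grid_corner_nested[OF l, of a i x d] unfolding r(2) unfolding b_b'_r_def j by blast+
    qed
    ultimately have "\<bar>c a l - c b r\<bar> \<le> K"
      unfolding K_def by (simp add: algebra_simps)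
    moreover have "W = hcube b r"
      by (simp only: x(2) grid_cell_def b_b'_r_def)
    ultimately show ?thesis using r(1) by blast
  qed

  define g where "g x = ennreal (min \<bar>f x - c a l\<bar> N)" for x
  have g: "g \<in> borel_measurable lebesgue"
    unfolding g_def using f by measurable
  have onU: "emeasure (density lebesgue g) (\<Union>F) \<le> ennreal (K + \<gamma>) * emeasure lebesgue (\<Union>F)"
  proof (rule emeasure_Union_le[OF F])
    fix W assume "W \<in> F"
    then obtain b r where r: "0 < r" "W = hcube b r" "\<bar>c a l - c b r\<bar> \<le> K"
      using center by blast
    have "emeasure (density lebesgue g) W = (\<integral>\<^sup>+x\<in>W. g x \<partial>lebesgue)"
      using r(2) g by (simp add: emeasure_density)
    also have "\<dots> \<le> (\<integral>\<^sup>+x. ennreal K * indicator W x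
        + ennreal (min \<bar>f x - c b r\<bar> N) * indicator W x \<partial>lebesgue)"
    proof (rule nn_integral_mono)
      fix x
      have "(min \<bar>f x - c a l\<bar> N) \<le> K + (min \<bar>f x - c b r\<bar> N)"
        using r(3) K by linarith
      then have "g x \<le> ennreal K + ennreal (min \<bar>f x - c b r\<bar> N)"
        using K N by (simp add: g_def ennreal_leI flip: ennreal_plus)
      then show "g x * indicator W x \<le> ennreal K * indicator W x
          + ennreal (min \<bar>f x - c b r\<bar> N) * indicator W x"
        by (simp split: split_indicator)
    qed
    also have "\<dots> = (\<integral>\<^sup>+x. ennreal K * indicator W x \<partial>lebesgue)
        + (\<integral>\<^sup>+x. ennreal (min \<bar>f x - c b r\<bar> N) * indicator W x \<partial>lebesgue)"
      using f r(2) by (intro nn_integral_add) (auto intro!: borel_measurable_times_ennreal)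
    also have "\<dots> = ennreal K * emeasure lebesgue W + trunc_osc N b r"
      using r(2) by (simp add: trunc_osc_def nn_integral_cmult_indicator)
    also have "\<dots> \<le> ennreal K * emeasure lebesgue W + ennreal (\<gamma> * r ^ CARD('n))"
      using bound[OF r(1)] by (rule add_left_mono)
    also have "\<dots> = ennreal K * emeasure lebesgue W + ennreal \<gamma> * emeasure lebesgue W"
      using r(1) \<gamma> by (simp add: r(2) emeasure_hcube[OF r(1)] ennreal_mult)
    also have "\<dots> = ennreal (K + \<gamma>) * emeasure lebesgue W"
      using K \<gamma> by (simp add: distrib_right)
    finally show "emeasure (density lebesgue g) W \<le> ennreal (K + \<gamma>) * emeasure lebesgue W" .
  qed simp
  \<comment> \<open>Outside the stopping cells the exceptional set has density at most \<open>1/2\<close> at all scales.\<close>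
  have "AE x in lebesgue. x \<notin> {x \<in> hcube a l \<inter> E. \<forall>k. emeasure lebesgue (E \<inter> grid_cell a l k x)
            \<le> ennreal (1/2) * emeasure lebesgue (grid_cell a l k x)}"
    by (intro AE_not_in null_sets_low_density l E) auto
  then have "AE x in lebesgue. g x * indicator (hcube a l - \<Union>F) x \<le> ennreal M * indicator (hcube a l) x"
  proof eventually_elim
    case (elim x)
    have "x \<notin> E" if "x \<in> hcube a l" "x \<notin> \<Union>F"
      using that elim unfolding F_def Union_stopping_cells[OF l] P_def by blast
    then show ?case
      by (auto split: split_indicator simp: E_def g_def min_def intro!: ennreal_leI)
  qed
  then have "(\<integral>\<^sup>+x\<in>hcube a l - \<Union>F. g x \<partial>lebesgue) \<le> (\<integral>\<^sup>+x. ennreal M * indicator (hcube a l) x \<partial>lebesgue)"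
    by (rule nn_integral_mono_AE)
  also have "\<dots> = ennreal (M * l ^ CARD('n))"
    using M l by (simp add: nn_integral_cmult_indicator emeasure_hcube[OF l] ennreal_mult)
  finally have offU: "(\<integral>\<^sup>+x\<in>hcube a l - \<Union>F. g x \<partial>lebesgue) \<le> ennreal (M * l ^ CARD('n))" .
  have "trunc_osc N a l = (\<integral>\<^sup>+x. g x * indicator (\<Union>F) x + g x * indicator (hcube a l - \<Union>F) x \<partial>lebesgue)"
    unfolding trunc_osc_def g_def using UH by (intro nn_integral_cong) (auto split: split_indicator)
  also have "\<dots> = (\<integral>\<^sup>+x\<in>\<Union>F. g x \<partial>lebesgue) + (\<integral>\<^sup>+x\<in>hcube a l - \<Union>F. g x \<partial>lebesgue)"
    using g U by (intro nn_integral_add) auto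
  also have "(\<integral>\<^sup>+x\<in>\<Union>F. g x \<partial>lebesgue) = emeasure (density lebesgue g) (\<Union>F)"
    using g U by (simp add: emeasure_density)
  also have "emeasure (density lebesgue g) (\<Union>F) + (\<integral>\<^sup>+x\<in>hcube a l - \<Union>F. g x \<partial>lebesgue)
      \<le> ennreal (K + \<gamma>) * ennreal (2 * t * l ^ CARD('n)) + ennreal (M * l ^ CARD('n))"
    by (intro add_mono offU order_trans[OF onU] mult_left_mono mU) simp
  also have "\<dots> = ennreal ((K + \<gamma>) * (2 * t * l ^ CARD('n)) + M * l ^ CARD('n))"
    using K \<gamma> t l M by (subst ennreal_plus) (auto simp: ennreal_mult)
  also have "(K + \<gamma>) * (2 * t * l ^ CARD('n)) + M * l ^ CARD('n) =
      (M + 2 * t * (2 * (real k + 1) * M + \<gamma>)) * l ^ CARD('n)"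
    unfolding K_def by (simp add: algebra_simps)
  finally show ?thesis .
qed

text \<open>Apply the step to the optimal \<open>\<gamma>\<close>, which is finite thanks to the truncation, and absorb
  \<open>2t\<gamma>\<close> into the left-hand side. The result does not depend on \<open>N\<close>.\<close>
lemma trunc_osc_bound:
  assumes l: "0 < l" and N: "0 \<le> N"
    and k: "0 < k" "t * (1 + (1 + 1 / real k) ^ CARD('n)) < 1"
  shows "trunc_osc N a l \<le> ennreal ((1 + 4 * t * (real k + 1)) / (1 - 2 * t) * M * l ^ CARD('n))"
proof -
  define I where "I = (UNIV :: (real ^ 'n) set) \<times> {0::real<..}"
  define h where "h = (\<lambda>(b, r). enn2real (trunc_osc N b r) / r ^ CARD('n))"
  have le_N: "trunc_osc N b r \<le> ennreal (N * r ^ CARD('n))" if "0 < r" for b r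
  proof -
    have "trunc_osc N b r \<le> (\<integral>\<^sup>+x. ennreal N * indicator (hcube b r) x \<partial>lebesgue)"
      unfolding trunc_osc_def
      by (intro nn_integral_mono) (auto split: split_indicator intro!: ennreal_leI)
    then show ?thesis
      using N that by (simp add: nn_integral_cmult_indicator emeasure_hcube[OF that] ennreal_mult)
  qed
  have osc_h: "trunc_osc N b r = ennreal (h (b, r) * r ^ CARD('n))" if "0 < r" for b r
    using le_N[OF that, of b] that by (auto simp: h_def top_unique less_top[symmetric] intro!: ennreal_enn2real[symmetric])
  have h0: "0 \<le> h (b, r)" if "0 < r" for b r
    using that by (simp add: h_def)
  have h_le: "h (b, r) \<le> y \<longleftrightarrow> trunc_osc N b r \<le> ennreal (y * r ^ CARD('n))"
    if "0 < r" "0 \<le> y" for b r y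
    using that h0[OF that(1), of b] by (simp add: osc_h ennreal_le_iff)
  have bdd: "bdd_above (h ` I)"
    using le_N h_le N by (intro bdd_aboveI2[of _ _ N]) (auto simp: I_def)
  define \<gamma> where "\<gamma> = (SUP i\<in>I. h i)"
  have h_\<gamma>: "h (b, r) \<le> \<gamma>" if "0 < r" for b r
    unfolding \<gamma>_def using that by (intro cSUP_upper bdd) (simp add: I_def)
  have \<gamma>: "0 \<le> \<gamma>"
    using h0[OF l, of a] h_\<gamma>[OF l, of a] by linarith
  have "h (b, r) \<le> M + 2 * t * (2 * (real k + 1) * M + \<gamma>)" if "0 < r" for b r
    using trunc_osc_step[OF that N \<gamma> _ k, of b] h_le h_\<gamma> \<gamma> that M t by simp
  then have "\<gamma> \<le> M + 2 * t * (2 * (real k + 1) * M + \<gamma>)"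
    unfolding \<gamma>_def by (intro cSUP_least) (auto simp: I_def)
  then have "\<gamma> * (1 - 2 * t) \<le> (1 + 4 * t * (real k + 1)) * M"
    by (simp add: algebra_simps)
  then have "\<gamma> \<le> (1 + 4 * t * (real k + 1)) / (1 - 2 * t) * M"
    using t by (simp add: field_simps)
  then show ?thesis
    using h_le[OF l] h_\<gamma>[OF l, of a] \<gamma> by (meson order_trans)
qed

lemma osc_bound:
  assumes l: "0 < l"
    and k: "0 < k" "t * (1 + (1 + 1 / real k) ^ CARD('n)) < 1"
  shows "(\<integral>\<^sup>+x\<in>cube a l. ennreal \<bar>f x - c a l\<bar> \<partial>lebesgue)
    \<le> ennreal ((1 + 4 * t * (real k + 1)) / (1 - 2 * t) * M * l ^ CARD('n))"
proof -
  define g where "g i x = ennreal (min \<bar>f x - c a l\<bar> (real i)) * indicator (hcube a l) x" for i x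
  have "AE x in lebesgue. x \<notin> cube a l - hcube a l"
    using negligible_cube_Diff_hcube negligible_iff_null_sets AE_not_in by blast
  then have "(\<integral>\<^sup>+x\<in>cube a l. ennreal \<bar>f x - c a l\<bar> \<partial>lebesgue) =
      (\<integral>\<^sup>+x\<in>hcube a l. ennreal \<bar>f x - c a l\<bar> \<partial>lebesgue)"
    using hcube_subset_cube[of a l]
    by (intro nn_integral_cong_AE) (auto elim!: eventually_mono split: split_indicator)
  also have "\<dots> = (\<integral>\<^sup>+x. (SUP i. g i x) \<partial>lebesgue)"
  proof (rule nn_integral_cong)
    fix x
    show "ennreal \<bar>f x - c a l\<bar> * indicator (hcube a l) x = (SUP i. g i x)"
    proof (rule antisym)
      obtain i where "\<bar>f x - c a l\<bar> \<le> real i" using real_arch_simple by blast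
      then have "ennreal \<bar>f x - c a l\<bar> * indicator (hcube a l) x = g i x"
        by (simp add: g_def min_absorb1)
      then show "ennreal \<bar>f x - c a l\<bar> * indicator (hcube a l) x \<le> (SUP i. g i x)"
        by (metis SUP_upper UNIV_I)
    qed (auto simp: g_def intro!: SUP_least mult_right_mono ennreal_leI)
  qed
  also have "\<dots> = (SUP i. \<integral>\<^sup>+x. g i x \<partial>lebesgue)"
    using f by (intro nn_integral_monotone_convergence_SUP)
      (auto simp: g_def incseq_def le_fun_def intro!: mult_right_mono ennreal_leI)
  also have "\<dots> \<le> ennreal ((1 + 4 * t * (real k + 1)) / (1 - 2 * t) * M * l ^ CARD('n))"
    using trunc_osc_bound[OF l _ k, of "real _" a] by (intro SUP_least) (simp add: trunc_osc_def g_def)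
  finally show ?thesis .
qed

end

lemma interpolation_steps_exist:
  fixes t :: real
  assumes "0 \<le> t" "t < 1 / 2"
  obtains k :: nat where "0 < k" "t * (1 + (1 + 1 / real k) ^ n) < 1"
proof -
  have "(\<lambda>k. t * (1 + (1 + inverse (real (Suc k))) ^ n)) \<longlonglongrightarrow> t * (1 + (1 + 0) ^ n)"
    by (intro tendsto_intros LIMSEQ_inverse_real_of_nat)
  then have "\<forall>\<^sub>F k in sequentially. t * (1 + (1 + inverse (real (Suc k))) ^ n) < 1"
    by (rule order_tendstoD(2)) (use assms in simp)
  then obtain k where "t * (1 + (1 + inverse (real (Suc k))) ^ n) < 1"
    by (auto simp: eventually_sequentially)
  then show thesis
    by (intro that[of "Suc k"]) (auto simp: divide_inverse)
qed

text \<open>The constant \<open>B\<close> depends only on \<open>t\<close> and the dimension, through the number \<open>k\<close> of interpolating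
  cubes; it blows up as \<open>t\<close> approaches \<open>1/2\<close>.\<close>
theorem john_stromberg:
  fixes t :: real
  assumes "0 \<le> t" "t < 1 / 2"
  obtains B :: real where "0 \<le> B"
    and "\<And>(f :: real ^ 'n \<Rightarrow> real) c M a l. local_centers f c M t \<Longrightarrow> 0 < l \<Longrightarrow>
      (\<integral>\<^sup>+x\<in>cube a l. ennreal \<bar>f x - c a l\<bar> \<partial>lebesgue) \<le> ennreal (B * M * l ^ CARD('n))"
proof -
  obtain k :: nat where k: "0 < k" "t * (1 + (1 + 1 / real k) ^ CARD('n)) < 1"
    using interpolation_steps_exist[OF assms] .
  show thesis
  proof (rule that[of "(1 + 4 * t * (real k + 1)) / (1 - 2 * t)"])
    show "0 \<le> (1 + 4 * t * (real k + 1)) / (1 - 2 * t)"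
      using assms by simp
  next
    fix f :: "real ^ 'n \<Rightarrow> real" and c M and a :: "real ^ 'n" and l :: real
    assume "local_centers f c M t" and l: "0 < l"
    interpret local_centers f c M t by fact
    show "(\<integral>\<^sup>+x\<in>cube a l. ennreal \<bar>f x - c a l\<bar> \<partial>lebesgue)
        \<le> ennreal ((1 + 4 * t * (real k + 1)) / (1 - 2 * t) * M * l ^ CARD('n))"
      by (rule osc_bound[OF l k])
  qed
qed

section \<open>Almost everywhere finiteness of sparse sums\<close>

lemma cube_eqD:
  assumes "cube a l = cube b r" "0 < l"
  shows "a = b" "l = r"
proof -
  have "cube a l \<noteq> {}"
    using assms(2) by (auto simp: cube_def interval_ne_empty_cart)
  then have "a = b \<and> (\<chi> i. a $ i + l) = (\<chi> i. b $ i + r)"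
    using assms(1) unfolding cube_def eq_cbox by auto
  then show "a = b" "l = r" by (auto simp: vec_eq_iff)
qed

text \<open>The cubes of the grid of side \<open>l / 2\<^sup>k\<close> anchored at \<open>a\<close>, in all of space; those with
  \<open>0 \<le> m\<^sub>i < 2\<^sup>k\<close> are the dyadic subcubes of \<open>cube a l\<close>. Countability and nesting can be read off
  from this form alone.\<close>
definition integral_cube :: "real ^ 'n \<Rightarrow> real \<Rightarrow> nat \<Rightarrow> int ^ 'n \<Rightarrow> (real ^ 'n) set" where
  "integral_cube a l k m = cube (\<chi> i. a $ i + l / 2 ^ k * of_int (m $ i)) (l / 2 ^ k)"

lemma dyadic_imp_integral_cube:
  assumes "P \<in> dyadic (cube a l)" and l: "0 < l"
  shows "\<exists>k m. P = integral_cube a l k m"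
  using assms(1)
proof induction
  case self
  show ?case
    by (intro exI[of _ 0] exI[of _ 0]) (simp add: integral_cube_def)
next
  case (subdivide b r v)
  then obtain k m where km: "cube b r = integral_cube a l k m" by blast
  have b: "b = (\<chi> i. a $ i + l / 2 ^ k * of_int (m $ i))" and r: "r = l / 2 ^ k"
    using cube_eqD[OF km[unfolded integral_cube_def] \<open>0 < r\<close>] by auto
  have v: "real_of_int \<lfloor>v $ i\<rfloor> = v $ i" for i
    using subdivide.hyps(3)[of i] by auto
  then have "b + (r / 2) *\<^sub>R v = (\<chi> i. a $ i + l / 2 ^ Suc k * of_int ((\<chi> i. 2 * m $ i + \<lfloor>v $ i\<rfloor>) $ i))"
    unfolding b r by (simp add: vec_eq_iff v algebra_simps)
  moreover have "r / 2 = l / 2 ^ Suc k" by (simp add: r)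
  ultimately show ?case unfolding integral_cube_def by metis
qed

lemma countable_dyadic:
  assumes "0 < l"
  shows "countable (dyadic (cube a l))"
proof (rule countable_subset)
  show "dyadic (cube a l) \<subseteq> range (\<lambda>(k, m). integral_cube a l k m)"
    using dyadic_imp_integral_cube[OF _ assms, of _ a] by fastforce
qed simp

lemma lmeasurable_dyadic:
  assumes "0 < l"
  shows "dyadic (cube a l) \<subseteq> lmeasurable"
proof
  fix P assume "P \<in> dyadic (cube a l)"
  then obtain k m where "P = integral_cube a l k m"
    using dyadic_imp_integral_cube[OF _ assms] by blast
  then show "P \<in> lmeasurable"
    by (simp add: integral_cube_def)
qed

definition closed_cell :: "real ^ 'n \<Rightarrow> real \<Rightarrow> nat \<Rightarrow> real ^ 'n \<Rightarrow> (real ^ 'n) set" where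
  "closed_cell a l k x = cube (grid_corner a l k x) (l / 2 ^ k)"

lemma closed_cell_self: "0 < l \<Longrightarrow> x \<in> closed_cell a l k x"
  using grid_cell_self[of l x a k] hcube_subset_cube
  unfolding closed_cell_def grid_cell_def by blast

lemma closed_cell_antimono:
  assumes "0 < l" "j \<le> k"
  shows "closed_cell a l k x \<subseteq> closed_cell a l j x"
proof -
  have "closed_cell a l (Suc k) x \<subseteq> closed_cell a l k x" for k
  proof
    fix y assume "y \<in> closed_cell a l (Suc k) x"
    then show "y \<in> closed_cell a l k x"
      using grid_corner_nested[OF assms(1), of a k x] unfolding closed_cell_def mem_cube
      by (meson order_trans)
  qed
  then show ?thesis
    using assms(2) by (rule lift_Suc_antimono_le[of "\<lambda>k. closed_cell a l k x"])
qed

lemma closed_cell_psubset_iff: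
  assumes "0 < l"
  shows "closed_cell a l k x \<subset> closed_cell a l j x \<longleftrightarrow> j < k"
proof
  show "j < k" if "closed_cell a l k x \<subset> closed_cell a l j x"
    using that closed_cell_antimono[OF assms, of k j a x] by (meson not_le psubsetE)
  show "closed_cell a l k x \<subset> closed_cell a l j x" if "j < k"
  proof -
    have "l / 2 ^ k < l / 2 ^ j"
      using that assms by (intro divide_strict_left_mono) auto
    then have "closed_cell a l k x \<noteq> closed_cell a l j x"
      using cube_eqD(2)[of "grid_corner a l k x" "l / 2 ^ k" "grid_corner a l j x" "l / 2 ^ j"] assms
      unfolding closed_cell_def by auto
    then show ?thesis
      using closed_cell_antimono[OF assms less_imp_le[OF that]] by blast
  qed
qed

text \<open>Closed dyadic cubes of one generation overlap only on the countably many hyperplanes of the grid.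
  Off these, the dyadic cubes that contain a given point form a chain.\<close>
lemma AE_dyadic_eq_closed_cell:
  fixes a :: "real ^ 'n"
  assumes l: "0 < l"
  shows "AE x in lebesgue. \<forall>P\<in>dyadic (cube a l). x \<in> P \<longrightarrow> (\<exists>k. P = closed_cell a l k x)"
proof -
  have "AE x in lebesgue. x $ i \<noteq> a $ i + l / 2 ^ k * (of_int z + 1)" for i k and z :: int
  proof -
    have "negligible {x :: real ^ 'n. x $ i = a $ i + l / 2 ^ k * (of_int z + 1)}"
      using negligible_standard_hyperplane[of "axis i (1::real)" "a $ i + l / 2 ^ k * (of_int z + 1)"]
      by (simp add: inner_axis)
    then show ?thesis
      using AE_not_in[of "{x :: real ^ 'n. x $ i = a $ i + l / 2 ^ k * (of_int z + 1)}" lebesgue]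
      by (simp add: negligible_iff_null_sets)
  qed
  then have "AE x in lebesgue. \<forall>i::'n. \<forall>k::nat. \<forall>z::int. x $ i \<noteq> a $ i + l / 2 ^ k * (of_int z + 1)"
    by (simp add: AE_all_countable)
  then show ?thesis
  proof eventually_elim
    case (elim x)
    show ?case
    proof (intro ballI impI)
      fix P assume P: "P \<in> dyadic (cube a l)" "x \<in> P"
      then obtain k m where km: "P = integral_cube a l k m"
        using dyadic_imp_integral_cube[OF _ l] by blast
      have "\<lfloor>(x $ i - a $ i) * 2 ^ k / l\<rfloor> = m $ i" for i
      proof -
        have "a $ i + l / 2 ^ k * of_int (m $ i) \<le> x $ i"
          "x $ i \<le> a $ i + l / 2 ^ k * of_int (m $ i) + l / 2 ^ k"
          using P(2) unfolding km integral_cube_def mem_cube by simp_all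
        moreover have "x $ i \<noteq> a $ i + l / 2 ^ k * (of_int (m $ i) + 1)"
          using elim by blast
        ultimately have "a $ i + l / 2 ^ k * of_int (m $ i) \<le> x $ i"
          "x $ i < a $ i + l / 2 ^ k * (of_int (m $ i) + 1)"
          by (simp_all add: distrib_left)
        then show ?thesis
          using l by (simp add: floor_eq_iff field_simps)
      qed
      then have "P = closed_cell a l k x"
        by (simp add: km integral_cube_def closed_cell_def grid_corner_def)
      then show "\<exists>k. P = closed_cell a l k x" ..
    qed
  qed
qed

text \<open>The cubes of \<open>S\<close> that contain \<open>x\<close> form an infinite chain, hence some of them are properly contained
  in \<open>P\<close>; the largest of those is a child of \<open>P\<close>.\<close>
lemma exists_child_containing:
  assumes l: "0 < l"
    and x: "\<And>P. P \<in> S \<Longrightarrow> x \<in> P \<Longrightarrow> \<exists>k. P = closed_cell a l k x"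
    and inf: "infinite {P \<in> S. x \<in> P}" and P: "P \<in> S" "x \<in> P"
  shows "\<exists>R\<in>ch S P. x \<in> R"
proof -
  obtain k where k: "P = closed_cell a l k x" using x[OF P] by blast
  define J where "J = {j. closed_cell a l j x \<in> S}"
  have "{P \<in> S. x \<in> P} \<subseteq> (\<lambda>j. closed_cell a l j x) ` J"
    using x by (fastforce simp: J_def)
  then have "infinite J"
    using inf finite_surj by blast
  then have ex: "\<exists>j. k < j \<and> j \<in> J"
    by (simp add: infinite_nat_iff_unbounded)
  define j where "j = (LEAST j. k < j \<and> j \<in> J)"
  have j: "k < j" "j \<in> J"
    using LeastI_ex[OF ex] by (simp_all add: j_def)
  have least: "j \<le> i" if "k < i" "i \<in> J" for i
    unfolding j_def using that by (simp add: Least_le)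
  have "closed_cell a l j x \<in> ch S P"
    unfolding ch_def
  proof (intro CollectI conjI notI)
    show "closed_cell a l j x \<in> S" "closed_cell a l j x \<subset> P"
      using j by (simp_all add: J_def k closed_cell_psubset_iff[OF l])
    assume "\<exists>R'\<in>S. closed_cell a l j x \<subset> R' \<and> R' \<subset> P"
    then obtain R where R: "R \<in> S" "closed_cell a l j x \<subset> R" "R \<subset> P" by blast
    then obtain i where i: "R = closed_cell a l i x"
      using x[OF R(1)] closed_cell_self[OF l, of x a j] by blast
    then have "i < j" "k < i" "i \<in> J"
      using R by (simp_all add: J_def k closed_cell_psubset_iff[OF l])
    then show False using least[of i] by simp
  qed
  then show ?thesis using closed_cell_self[OF l] by blast
qed

text \<open>Countable subadditivity, in a form suited to the unordered sums in the definition of sparseness.\<close>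
lemma emeasure_Int_Union_le_infsum:
  assumes "countable F" "F \<subseteq> sets M" and Z: "Z \<in> sets M"
    and le: "\<And>R. R \<in> F \<Longrightarrow> emeasure M (Z \<inter> R) \<le> C * emeasure M R"
  shows "emeasure M (Z \<inter> \<Union>F) \<le> C * (\<Sum>\<^sub>\<infinity>R\<in>F. emeasure M R)"
proof (cases "F = {}")
  case False
  define g where "g = from_nat_into F"
  have g: "range g = F"
    unfolding g_def using False assms(1) by (rule range_from_nat_into)
  have gs: "g i \<in> sets M" for i using g assms(2) by blast
  have "emeasure M (Z \<inter> \<Union>F) = emeasure M (\<Union>n. Z \<inter> (\<Union>i\<le>n. g i))"
    by (rule arg_cong[where f = "emeasure M"]) (auto simp flip: g)
  also have "\<dots> = (SUP n. emeasure M (Z \<inter> (\<Union>i\<le>n. g i)))"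
  proof (rule SUP_emeasure_incseq[symmetric])
    show "incseq (\<lambda>n. Z \<inter> (\<Union>i\<le>n. g i))"
      by (fastforce simp: incseq_def intro: order_trans)
  qed (use gs Z in auto)
  also have "\<dots> \<le> C * (\<Sum>\<^sub>\<infinity>R\<in>F. emeasure M R)"
  proof (rule SUP_least)
    fix n
    define G where "G = g ` {..n}"
    have G: "finite G" "G \<subseteq> F" using g by (auto simp: G_def)
    have "emeasure M (Z \<inter> (\<Union>i\<le>n. g i)) = emeasure M (\<Union>R\<in>G. Z \<inter> R)"
      by (rule arg_cong[where f = "emeasure M"]) (auto simp: G_def)
    also have "\<dots> \<le> (\<Sum>R\<in>G. emeasure M (Z \<inter> R))"
      using G Z assms(2) by (intro emeasure_subadditive_finite) auto
    also have "\<dots> \<le> (\<Sum>R\<in>G. C * emeasure M R)"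
      using le G by (intro sum_mono) auto
    also have "\<dots> = C * (\<Sum>R\<in>G. emeasure M R)"
      by (simp add: sum_distrib_left)
    also have "\<dots> \<le> C * (\<Sum>\<^sub>\<infinity>R\<in>F. emeasure M R)"
      using G by (subst nonneg_infsum_complete) (auto intro!: mult_left_mono SUP_upper)
    finally show "emeasure M (Z \<inter> (\<Union>i\<le>n. g i)) \<le> C * (\<Sum>\<^sub>\<infinity>R\<in>F. emeasure M R)" .
  qed
  finally show ?thesis .
qed simp

lemma sets_infinitely_often:
  assumes "countable S" "S \<subseteq> sets M"
  shows "{x \<in> space M. infinite {P \<in> S. x \<in> P}} \<in> sets M"
proof (cases "finite S")
  case False
  define e where "e = from_nat_into S"
  have e: "inj e" "range e = S"
    using bij_betw_from_nat_into[OF assms(1) False] by (auto simp: e_def bij_betw_def)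
  have "infinite {P \<in> S. x \<in> P} \<longleftrightarrow> (\<forall>n. \<exists>m\<ge>n. x \<in> e m)" for x
  proof -
    have "{P \<in> S. x \<in> P} = e ` {m. x \<in> e m}" using e(2) by auto
    then have "infinite {P \<in> S. x \<in> P} \<longleftrightarrow> infinite {m. x \<in> e m}"
      using e(1) by (simp add: finite_image_iff inj_on_subset)
    then show ?thesis by (simp add: infinite_nat_iff_unbounded_le)
  qed
  then have "{x \<in> space M. infinite {P \<in> S. x \<in> P}} = space M \<inter> (\<Inter>n. \<Union>m\<in>{n..}. e m)"
    by auto
  also have "\<dots> \<in> sets M"
    using e(2) assms(2) by (intro sets.Int sets.top sets.countable_INT sets.countable_UN') auto
  finally show ?thesis .
qed simp

text \<open>Let \<open>Z\<close> be the set of the points that lie in infinitely many cubes. As \<open>Z \<inter> P\<close> is covered by the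
  children of \<open>P\<close> up to a null set, a bound \<open>\<bar>Z \<inter> R\<bar> \<le> \<theta>\<bar>R\<bar>\<close> for all \<open>R\<close> in the family improves itself to one with
  \<open>(1 - \<eta>)\<theta>\<close>.\<close>
lemma AE_finite_sparse:
  fixes a :: "real ^ 'n"
  assumes l: "0 < l" and S: "S \<subseteq> dyadic (cube a l)" and sp: "sparse \<eta> S" and \<eta>: "0 < \<eta>" "\<eta> < 1"
  shows "AE x in lebesgue. finite {P \<in> S. x \<in> P}"
proof -
  define Z where "Z = {x. infinite {P \<in> S. x \<in> P}}"
  have count: "countable S"
    using countable_subset[OF S countable_dyadic[OF l]] .
  have Slm: "S \<subseteq> lmeasurable"
    using S lmeasurable_dyadic[OF l] by (rule order_trans)
  then have Sset: "S \<subseteq> sets lebesgue" by auto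
  have Z: "Z \<in> sets lebesgue"
    using sets_infinitely_often[OF count Sset] by (simp add: Z_def)
  have geometric: "emeasure lebesgue (Z \<inter> P) \<le> ennreal ((1 - \<eta>) ^ n) * emeasure lebesgue P"
    if "P \<in> S" for n P
    using that
  proof (induction n arbitrary: P)
    case 0
    then show ?case using Sset by (auto intro!: emeasure_mono)
  next
    case (Suc n)
    have chS: "ch S P \<subseteq> S" by (auto simp: ch_def)
    have "AE x in lebesgue. x \<in> Z \<inter> P \<longrightarrow> x \<in> Z \<inter> \<Union>(ch S P)"
      using AE_dyadic_eq_closed_cell[OF l, of a]
    proof eventually_elim
      case (elim x)
      then show ?case
        using exists_child_containing[OF l, of S x a P] Suc.prems S by (auto simp: Z_def)
    qed
    then have "emeasure lebesgue (Z \<inter> P) \<le> emeasure lebesgue (Z \<inter> \<Union>(ch S P))"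
      using Z sets.countable_Union[OF countable_subset[OF chS count] order_trans[OF chS Sset]]
      by (intro emeasure_mono_AE) auto
    also have "\<dots> \<le> ennreal ((1 - \<eta>) ^ n) * (\<Sum>\<^sub>\<infinity>R\<in>ch S P. emeasure lebesgue R)"
      using chS Suc.IH by (intro emeasure_Int_Union_le_infsum countable_subset[OF chS count] Z
          order_trans[OF chS Sset]) auto
    also have "\<dots> \<le> ennreal ((1 - \<eta>) ^ n) * (ennreal (1 - \<eta>) * emeasure lebesgue P)"
      using sp Suc.prems by (intro mult_left_mono) (auto simp: sparse_def)
    also have "\<dots> = ennreal ((1 - \<eta>) ^ Suc n) * emeasure lebesgue P"
      using \<eta> by (simp add: ennreal_mult mult_ac)
    finally show ?case .
  qed
  have null: "Z \<inter> P \<in> null_sets lebesgue" if "P \<in> S" for P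
  proof -
    have P: "P \<in> lmeasurable" using that Slm by blast
    then have ZP: "Z \<inter> P \<in> lmeasurable" using fmeasurable_Int_fmeasurable[OF P Z] by (simp add: Int_commute)
    have "measure lebesgue (Z \<inter> P) \<le> (1 - \<eta>) ^ n * measure lebesgue P" for n
      using geometric[OF that, of n] \<eta>
      by (simp add: emeasure_eq_measure2[OF P] emeasure_eq_measure2[OF ZP] ennreal_le_iff flip: ennreal_mult)
    moreover have "(\<lambda>n. (1 - \<eta>) ^ n * measure lebesgue P) \<longlonglongrightarrow> 0 * measure lebesgue P"
      using \<eta> by (intro tendsto_intros LIMSEQ_power_zero) auto
    ultimately have "measure lebesgue (Z \<inter> P) \<le> 0"
      by (intro LIMSEQ_le_const[of _ 0]) auto
    then have "measure lebesgue (Z \<inter> P) = 0" by (simp add: antisym)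
    then show ?thesis using ZP emeasure_eq_measure2[OF ZP] by (auto simp: null_sets_def)
  qed
  have "Z \<subseteq> \<Union>S"
  proof
    fix x assume "x \<in> Z"
    then have "infinite {P \<in> S. x \<in> P}" by (simp add: Z_def)
    then have "{P \<in> S. x \<in> P} \<noteq> {}" by (rule infinite_imp_nonempty)
    then show "x \<in> \<Union>S" by blast
  qed
  then have "Z = (\<Union>P\<in>S. Z \<inter> P)" by blast
  also have "\<dots> \<in> null_sets lebesgue"
    using null by (intro null_sets_UN' count) auto
  finally show ?thesis
    by (auto dest!: AE_not_in simp: Z_def)
qed

lemma sparse_sum_finite:
  assumes "finite {P \<in> S. x \<in> P}"
  shows "sparse_sum S x < \<infinity>"
proof -
  have "sparse_sum S x = (\<Sum>\<^sub>\<infinity>P\<in>{P \<in> S. x \<in> P}. indicator P x)"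
    unfolding sparse_sum_def by (intro infsum_cong_neutral) auto
  also have "\<dots> = (\<Sum>P\<in>{P \<in> S. x \<in> P}. 1)"
    using assms by (auto intro!: sum.cong)
  also have "\<dots> < \<infinity>"
    by (simp add: of_nat_less_top)
  finally show ?thesis .
qed

section \<open>Comparison of the oscillation seminorms\<close>

text \<open>Replacing an arbitrary constant by the average at most doubles the mean oscillation.\<close>
lemma bmo_norm_le_of_osc:
  fixes f :: "real ^ 'n \<Rightarrow> real"
  assumes f: "f \<in> L1_loc" and \<beta>: "0 \<le> \<beta>"
    and osc: "\<And>a l. 0 < l \<Longrightarrow>
      (\<integral>\<^sup>+x\<in>cube a l. ennreal \<bar>f x - c a l\<bar> \<partial>lebesgue) \<le> ennreal (\<beta> * l ^ CARD('n))"
  shows "bmo_norm f \<le> ennreal (2 * \<beta>)"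
  unfolding bmo_norm_def
proof (rule SUP_least)
  fix Q :: "(real ^ 'n) set" assume "Q \<in> cubes"
  then obtain a l where Q: "Q = cube a l" "0 < l" by (auto simp: cubes_def)
  define V where "V = l ^ CARD('n)"
  define d where "d = c a l"
  define I where "I = (LINT x:Q|lebesgue. \<bar>f x - d\<bar>)"
  have V: "0 < V" "measure lebesgue Q = V"
    using Q by (simp_all add: V_def measure_cube)
  have Qlm: "Q \<in> lmeasurable" by (simp add: Q)
  have ind: "integrable lebesgue (indicat_real Q)"
    using Qlm by (intro integrable_real_indicator) (auto simp: fmeasurable_def)
  then have const: "set_integrable lebesgue Q (\<lambda>x. y)" for y :: real
    unfolding set_integrable_def by (intro integrable_scaleR_left) simp
  have const_int: "(LINT x:Q|lebesgue. y) = y * V" for y :: real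
  proof -
    have "(LINT x:Q|lebesgue. y) = (LINT x|lebesgue. indicat_real Q x) *\<^sub>R y"
      unfolding set_lebesgue_integral_def by (rule integral_scaleR_left) (use ind in simp)
    then show ?thesis by (simp add: V(2))
  qed
  have "compact Q" by (simp add: Q cube_def)
  then have fQ: "set_integrable lebesgue Q f"
    using f by (simp add: L1_loc_def)
  have dQ: "set_integrable lebesgue Q (\<lambda>x. f x - y)" for y
    by (rule set_integral_diff(1)[OF fQ const])
  have absQ: "set_integrable lebesgue Q (\<lambda>x. \<bar>f x - y\<bar>)" for y
    using set_integrable_abs[OF dQ] .
  have "ennreal I = (\<integral>\<^sup>+x. ennreal (indicator Q x *\<^sub>R \<bar>f x - d\<bar>) \<partial>lebesgue)"
    unfolding I_def set_lebesgue_integral_def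
    by (rule nn_integral_eq_integral[symmetric]) (use absQ[of d] in \<open>auto simp: set_integrable_def\<close>)
  also have "\<dots> = (\<integral>\<^sup>+x\<in>cube a l. ennreal \<bar>f x - c a l\<bar> \<partial>lebesgue)"
    by (intro nn_integral_cong) (auto simp: d_def Q split: split_indicator)
  also have "\<dots> \<le> ennreal (\<beta> * V)"
    unfolding V_def by (rule osc[OF Q(2)])
  finally have I: "I \<le> \<beta> * V"
    using V \<beta> by (simp add: ennreal_le_iff)
  have "(LINT x:Q|lebesgue. f x - d) = (LINT x:Q|lebesgue. f x) - d * V"
    by (simp only: set_integral_diff(2)[OF fQ const] const_int)
  also have "\<dots> = (average f Q - d) * V"
    using V by (simp add: average_def left_diff_distrib)
  finally have "\<bar>d - average f Q\<bar> * V = \<bar>LINT x:Q|lebesgue. f x - d\<bar>"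
    using V(1) by (simp add: abs_mult abs_minus_commute)
  also have "\<dots> \<le> I"
    unfolding I_def using set_integral_norm_bound[OF dQ[of d]] by simp
  finally have avg: "\<bar>d - average f Q\<bar> * V \<le> I" .
  have "(LINT x:Q|lebesgue. \<bar>f x - average f Q\<bar>) \<le> (LINT x:Q|lebesgue. \<bar>f x - d\<bar> + \<bar>d - average f Q\<bar>)"
    by (intro set_integral_mono absQ set_integral_add(1) const) linarith
  also have "\<dots> = I + \<bar>d - average f Q\<bar> * V"
    by (simp add: set_integral_add(2)[OF absQ const] const_int I_def)
  also have "\<dots> \<le> 2 * (\<beta> * V)"
    using avg I by linarith
  finally have "average (\<lambda>x. \<bar>f x - average f Q\<bar>) Q \<le> 2 * \<beta>"
    using V unfolding average_def[of "\<lambda>x. \<bar>f x - average f Q\<bar>"] by (simp add: field_simps)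
  then show "ennreal (average (\<lambda>x. \<bar>f x - average f Q\<bar>) Q) \<le> ennreal (2 * \<beta>)"
    by (rule ennreal_leI)
qed

text \<open>A Chebyshev inequality: if the superlevel set \<open>E\<close> were larger than the fraction \<open>t\<close>, the
  definition of \<open>\<Lambda>\<close> would force \<open>\<parallel>\<chi>\<^sub>E\<parallel> \<ge> \<Lambda> c\<^sub>0\<close>, whereas \<open>\<chi>\<^sub>E \<le> \<bar>g\<bar> / M\<close> gives
  \<open>\<parallel>\<chi>\<^sub>E\<parallel> < \<delta> / M = \<Lambda> c\<^sub>0\<close>.\<close>
lemma measure_superlevel_le_Lambda:
  fixes X :: "(real ^ 'n) set \<Rightarrow> (real ^ 'n) function_space"
  assumes X: "quasi_banach_function_space (lebesgue_on Q) (X Q)" and Q: "Q \<in> cubes"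
    and chi: "ennreal c\<^sub>0 \<le> ext_qnorm (X Q) (indicat_real Q)"
      "ext_qnorm (X Q) (indicat_real Q) < \<infinity>" "0 < c\<^sub>0"
    and \<Lambda>: "0 < \<Lambda>" "ennreal \<Lambda> \<le> Lambda_fam X t"
    and g: "g \<in> borel_measurable lebesgue" "ext_qnorm (X Q) g < ennreal \<delta>"
  shows "measure lebesgue {x \<in> Q. \<delta> / (\<Lambda> * c\<^sub>0) < \<bar>g x\<bar>} \<le> t * measure lebesgue Q"
proof (rule ccontr)
  interpret quasi_banach_function_space "lebesgue_on Q" "X Q" by (rule X)
  define M where "M = \<delta> / (\<Lambda> * c\<^sub>0)"
  define E where "E = {x \<in> Q. M < \<bar>g x\<bar>}"
  assume "\<not> measure lebesgue {x \<in> Q. \<delta> / (\<Lambda> * c\<^sub>0) < \<bar>g x\<bar>} \<le> t * measure lebesgue Q"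
  then have big: "t * measure lebesgue Q \<le> measure lebesgue E"
    by (simp add: E_def M_def)
  have \<delta>: "0 < \<delta>"
    using g(2) by (cases "0 < \<delta>") (auto simp: ennreal_neg)
  then have M: "0 < M" using \<Lambda> chi(3) by (simp add: M_def)
  have Qlm: "Q \<in> lmeasurable" using Q by (auto simp: cubes_def)
  have E: "E \<in> lmeasurable"
    using lmeasurable_superlevel[OF g(1) Qlm, of M 0] by (simp add: E_def)
  have gX: "g \<in> fs_carrier (X Q)" "fs_qnorm (X Q) g < \<delta>"
    using g(2) \<delta> by (auto simp: ext_qnorm_def ennreal_less_iff qnorm_nonneg split: if_splits)
  have "indicat_real E \<in> fs_carrier (X Q) \<and>
      fs_qnorm (X Q) (indicat_real E) \<le> fs_qnorm (X Q) (\<lambda>x. (1 / M) * g x)"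
  proof (rule ideal)
    show "indicat_real E \<in> borel_measurable (lebesgue_on Q)"
      using E by (intro measurable_restrict_space1 borel_measurable_indicator) auto
    show "(\<lambda>x. 1 / M * g x) \<in> fs_carrier (X Q)"
      by (rule scale_mem[OF gX(1)])
    show "AE x in lebesgue_on Q. \<bar>indicat_real E x\<bar> \<le> \<bar>1 / M * g x\<bar>"
      using M by (auto simp: E_def indicator_def abs_mult field_simps)
  qed
  then have chiE: "indicat_real E \<in> fs_carrier (X Q)"
      "fs_qnorm (X Q) (indicat_real E) \<le> fs_qnorm (X Q) g / M"
    using qnorm_scale[OF gX(1), of "1 / M"] M by auto
  note chiE(2)
  also have "fs_qnorm (X Q) g / M < \<delta> / M"
    using gX(2) M by (rule divide_strict_right_mono)
  also have "\<delta> / M = \<Lambda> * c\<^sub>0"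
    using \<delta> \<Lambda> chi(3) by (simp add: M_def)
  finally have small: "ext_qnorm (X Q) (indicat_real E) < ennreal (\<Lambda> * c\<^sub>0)"
    using chiE(1) \<Lambda> chi(3) by (simp add: ext_qnorm_def ennreal_less_iff qnorm_nonneg)
  have "ennreal \<Lambda> \<le> ext_qnorm (X Q) (indicat_real E) / ext_qnorm (X Q) (indicat_real Q)"
    using \<Lambda>(2) Q E big unfolding Lambda_fam_def le_INF_iff by (auto simp: E_def)
  then have "ennreal \<Lambda> * ext_qnorm (X Q) (indicat_real Q) \<le>
      ext_qnorm (X Q) (indicat_real E) / ext_qnorm (X Q) (indicat_real Q) * ext_qnorm (X Q) (indicat_real Q)"
    by (rule mult_right_mono) simp
  also have "\<dots> = ext_qnorm (X Q) (indicat_real E)"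
  proof -
    have "ext_qnorm (X Q) (indicat_real Q) \<noteq> 0"
      using chi(1,3) by auto
    then show ?thesis
      using chi(2) by (simp add: ennreal_divide_times)
  qed
  finally have "ennreal \<Lambda> * ennreal c\<^sub>0 \<le> ext_qnorm (X Q) (indicat_real E)"
    using mult_left_mono[OF chi(1), of "ennreal \<Lambda>"] by simp
  then show False
    using small \<Lambda>(1) chi(3) by (simp add: ennreal_mult not_less[symmetric])
qed

lemma bmo_norm_le_bmo_X_star_norm:
  fixes X :: "(real ^ 'n) set \<Rightarrow> (real ^ 'n) function_space"
  assumes X: "\<And>Q. Q \<in> cubes \<Longrightarrow> quasi_banach_function_space (lebesgue_on Q) (X Q)"
    and chi: "\<And>Q. Q \<in> cubes \<Longrightarrow> ennreal c\<^sub>0 \<le> ext_qnorm (X Q) (indicat_real Q)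
      \<and> ext_qnorm (X Q) (indicat_real Q) \<le> ennreal C\<^sub>0" "0 < c\<^sub>0"
    and t: "0 < t" "t < 1 / 2" and Lambda: "Lambda_fam X t > 0"
  obtains K :: real where "0 \<le> K"
    "\<And>f. f \<in> BMO_X_star X \<inter> L1_loc \<Longrightarrow> bmo_norm f \<le> ennreal K * bmo_X_star_norm X f"
proof -
  obtain \<Lambda>' where "0 < \<Lambda>'" "\<Lambda>' < Lambda_fam X t"
    using Lambda dense by blast
  then obtain \<Lambda> where \<Lambda>: "0 < \<Lambda>" "ennreal \<Lambda> \<le> Lambda_fam X t"
    by (cases \<Lambda>') auto
  obtain B :: real where B: "0 \<le> B"
    and JS: "\<And>(f :: real ^ 'n \<Rightarrow> real) c M a l. local_centers f c M t \<Longrightarrow> 0 < l \<Longrightarrow>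
      (\<integral>\<^sup>+x\<in>cube a l. ennreal \<bar>f x - c a l\<bar> \<partial>lebesgue) \<le> ennreal (B * M * l ^ CARD('n))"
    using john_stromberg[OF less_imp_le[OF t(1)] t(2), where 'n = 'n] by blast
  define K where "K = 2 * B / (\<Lambda> * c\<^sub>0)"
  have K: "0 \<le> K" using B \<Lambda> chi(2) by (simp add: K_def)
  have main: "bmo_norm f \<le> ennreal (K * \<delta>)"
    if f: "f \<in> L1_loc" and \<delta>: "0 < \<delta>" "bmo_X_star_norm X f < ennreal \<delta>" for f \<delta>
  proof -
    have fm: "f \<in> borel_measurable lebesgue" using f by (simp add: L1_loc_def)
    have ex: "\<exists>d. ext_qnorm (X (cube a l)) (\<lambda>x. f x - d) < ennreal \<delta>" if "0 < l" for a l
    proof -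
      have "(INF d. ext_qnorm (X (cube a l)) (\<lambda>x. f x - d)) \<le> bmo_X_star_norm X f"
        unfolding bmo_X_star_norm_def using that by (intro SUP_upper) (auto simp: cubes_def)
      then show ?thesis
        using \<delta>(2) by (auto simp: INF_less_iff dest: le_less_trans)
    qed
    define c where "c a l = (SOME d. ext_qnorm (X (cube a l)) (\<lambda>x. f x - d) < ennreal \<delta>)" for a l
    have c: "ext_qnorm (X (cube a l)) (\<lambda>x. f x - c a l) < ennreal \<delta>" if "0 < l" for a l
      unfolding c_def by (rule someI_ex[OF ex[OF that]])
    have pos: "0 < \<delta> / (\<Lambda> * c\<^sub>0)"
      using \<delta>(1) \<Lambda>(1) chi(2) by simp
    have "bmo_norm f \<le> ennreal (2 * (B * (\<delta> / (\<Lambda> * c\<^sub>0))))"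
    proof (rule bmo_norm_le_of_osc[OF f, where c = c])
      show "0 \<le> B * (\<delta> / (\<Lambda> * c\<^sub>0))"
        by (rule mult_nonneg_nonneg[OF B less_imp_le[OF pos]])
      fix a :: "real ^ 'n" and l :: real assume l: "0 < l"
      show "(\<integral>\<^sup>+x\<in>cube a l. ennreal \<bar>f x - c a l\<bar> \<partial>lebesgue)
          \<le> ennreal (B * (\<delta> / (\<Lambda> * c\<^sub>0)) * l ^ CARD('n))"
      proof (intro JS[OF _ l] local_centers.intro fm less_imp_le[OF t(1)] t(2))
        show "0 \<le> \<delta> / (\<Lambda> * c\<^sub>0)" by (rule less_imp_le[OF pos])
        fix b :: "real ^ 'n" and r :: real assume r: "0 < r"
        then have Q: "cube b r \<in> cubes" by (auto simp: cubes_def)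
        have "measure lebesgue {x \<in> cube b r. \<delta> / (\<Lambda> * c\<^sub>0) < \<bar>f x - c b r\<bar>}
            \<le> t * measure lebesgue (cube b r)"
          using chi(1)[OF Q] fm
          by (intro measure_superlevel_le_Lambda[OF X[OF Q] Q _ _ chi(2) \<Lambda> _ c[OF r]]) (auto intro: le_less_trans)
        then show "measure lebesgue {x \<in> cube b r. \<delta> / (\<Lambda> * c\<^sub>0) < \<bar>f x - c b r\<bar>} \<le> t * r ^ CARD('n)"
          by (simp add: measure_cube[OF r])
      qed
    qed
    then show ?thesis by (simp add: K_def mult_ac)
  qed
  show thesis
  proof (rule that[OF K])
    \<comment> \<open>The infimum over \<open>c\<close> need not be attained and the seminorm may vanish, so \<open>\<delta>\<close> has to
      approach the seminorm \<open>s\<close> from above.\<close>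
    fix f assume f: "f \<in> BMO_X_star X \<inter> L1_loc"
    then obtain s where s: "bmo_X_star_norm X f = ennreal s" "0 \<le> s"
      by (cases "bmo_X_star_norm X f") (auto simp: BMO_X_star_def)
    have "bmo_norm f \<le> ennreal (K * s)"
    proof (rule ennreal_le_epsilon)
      fix e :: real assume e: "0 < e"
      have "bmo_norm f \<le> ennreal (K * (s + e / (K + 1)))"
        using f s e K by (intro main) (auto simp: ennreal_less_iff add_nonneg_pos)
      also have "\<dots> \<le> ennreal (K * s + e)"
        using e K by (intro ennreal_leI) (simp add: field_simps)
      finally show "bmo_norm f \<le> ennreal (K * s) + ennreal e"
        using e K s by simp
    qed
    then show "bmo_norm f \<le> ennreal K * bmo_X_star_norm X f"
      using K s by (simp add: ennreal_mult)
  qed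
qed

lemma bmo_X_norm_le_bmo_norm:
  fixes X :: "(real ^ 'n) set \<Rightarrow> (real ^ 'n) function_space"
  assumes sd: "sparse_domination TYPE('n) \<eta> C"
    and X: "\<And>Q. Q \<in> cubes \<Longrightarrow> quasi_banach_function_space (lebesgue_on Q) (X Q)"
    and T: "T_fam X \<eta> < \<infinity>" and f: "f \<in> BMO"
  shows "bmo_X_norm X f \<le> ennreal (C * enn2real (T_fam X \<eta>)) * bmo_norm f"
  unfolding bmo_X_norm_def
proof (rule SUP_least)
  fix Q :: "(real ^ 'n) set" assume Q: "Q \<in> cubes"
  then obtain a l where al: "Q = cube a l" "0 < l" by (auto simp: cubes_def)
  interpret quasi_banach_function_space "lebesgue_on Q" "X Q" by (rule X[OF Q])
  obtain b where b: "bmo_norm f = ennreal b" "0 \<le> b"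
    using f by (cases "bmo_norm f") (auto simp: BMO_def)
  have \<eta>: "0 < \<eta>" "\<eta> < 1" and C: "0 < C"
    using sd by (auto simp: sparse_domination_def)
  obtain S where S: "S \<subseteq> dyadic Q" "sparse \<eta> S"
    and dom: "AE x in lebesgue_on Q. ennreal \<bar>f x - average f Q\<bar> \<le> ennreal C * bmo_norm f * sparse_sum S x"
    using sd f Q unfolding sparse_domination_def by blast
  define g where "g x = enn2real (sparse_sum S x)" for x
  have "ext_qnorm (X Q) g \<le> T_fam X \<eta>"
    unfolding T_fam_def g_def using S Q by (intro SUP_upper2[OF Q] SUP_upper) simp
  then have gX: "g \<in> fs_carrier (X Q)" "ennreal (fs_qnorm (X Q) g) \<le> T_fam X \<eta>"
    using T by (auto simp: ext_qnorm_def top_unique split: if_splits)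
  then have gT: "fs_qnorm (X Q) g \<le> enn2real (T_fam X \<eta>)"
    using T qnorm_nonneg[OF gX(1)] by (cases "T_fam X \<eta>") auto
  have "AE x in lebesgue_on Q. finite {P \<in> S. x \<in> P}"
    using AE_finite_sparse[OF al(2) S[unfolded al(1)] \<eta>] by (subst AE_restrict_space_iff) (auto simp: al)
  with dom have "AE x in lebesgue_on Q. \<bar>f x - average f Q\<bar> \<le> \<bar>C * b * g x\<bar>"
  proof eventually_elim
    case (elim x)
    have "sparse_sum S x = ennreal (g x)"
      using sparse_sum_finite[OF elim(2)] by (simp add: g_def)
    then have "ennreal \<bar>f x - average f Q\<bar> \<le> ennreal (C * b * g x)"
      using elim(1) C b by (simp add: ennreal_mult g_def)
    then show ?case using C b by (simp add: ennreal_le_iff g_def)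
  qed
  moreover have "(\<lambda>x. f x - average f Q) \<in> borel_measurable (lebesgue_on Q)"
    using f by (intro measurable_restrict_space1 borel_measurable_diff) (auto simp: BMO_def L1_loc_def)
  ultimately have "(\<lambda>x. f x - average f Q) \<in> fs_carrier (X Q) \<and>
      fs_qnorm (X Q) (\<lambda>x. f x - average f Q) \<le> fs_qnorm (X Q) (\<lambda>x. C * b * g x)"
    by (intro ideal scale_mem gX(1))
  then have "ext_qnorm (X Q) (\<lambda>x. f x - average f Q) \<le> ennreal (C * b * fs_qnorm (X Q) g)"
    using qnorm_scale[OF gX(1), of "C * b"] C b by (simp add: ext_qnorm_def ennreal_leI)
  also have "\<dots> \<le> ennreal (C * b * enn2real (T_fam X \<eta>))"
    using gT C b by (intro ennreal_leI mult_left_mono) auto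
  also have "\<dots> = ennreal (C * enn2real (T_fam X \<eta>)) * bmo_norm f"
    using C b by (simp add: b(1) mult_ac flip: ennreal_mult)
  finally show "ext_qnorm (X Q) (\<lambda>x. f x - average f Q) \<le>
      ennreal (C * enn2real (T_fam X \<eta>)) * bmo_norm f" .
qed

lemma bmo_X_star_norm_le_bmo_X_norm: "bmo_X_star_norm X f \<le> bmo_X_norm X f"
  unfolding bmo_X_star_norm_def bmo_X_norm_def by (intro SUP_mono' INF_lower) simp

lemma equivalent_seminorms_onI:
  assumes "0 \<le> K" "0 \<le> L"
    and pq: "\<And>f. f \<in> A \<Longrightarrow> p f \<le> ennreal K * q f"
    and qp: "\<And>f. f \<in> A \<Longrightarrow> q f \<le> ennreal L * p f"
  shows "equivalent_seminorms_on A p q"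
  unfolding equivalent_seminorms_on_def
proof (intro exI conjI ballI)
  show "0 < 1 / (K + 1)" "0 < L + 1" using assms by auto
  fix f assume f: "f \<in> A"
  have "ennreal (1 / (K + 1)) * p f \<le> ennreal (1 / (K + 1)) * (ennreal (K + 1) * q f)"
    using assms(1) by (intro mult_left_mono order_trans[OF pq[OF f]] mult_right_mono ennreal_leI) auto
  also have "\<dots> = q f"
  proof -
    have "ennreal (1 / (K + 1)) * ennreal (K + 1) = 1"
      using assms(1) by (subst ennreal_mult[symmetric]) auto
    then show ?thesis by (simp only: mult.assoc[symmetric] mult_1)
  qed
  finally show "ennreal (1 / (K + 1)) * p f \<le> q f" .
  show "q f \<le> ennreal (L + 1) * p f"
    using assms(2) by (intro order_trans[OF qp[OF f]] mult_right_mono ennreal_leI) auto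
qed

theorem proposition5p1:
  fixes X :: "(real ^ 'n) set \<Rightarrow> (real ^ 'n) function_space"
    and \<eta>\<^sub>0 C\<^sub>n c\<^sub>0 C\<^sub>0 t :: real
  assumes "sparse_domination TYPE('n) \<eta>\<^sub>0 C\<^sub>n"
    and "\<And>Q. Q \<in> cubes \<Longrightarrow> quasi_banach_function_space (lebesgue_on Q) (X Q)"
    and "0 < c\<^sub>0" and "c\<^sub>0 \<le> C\<^sub>0"
    and "\<And>Q. Q \<in> cubes \<Longrightarrow> ennreal c\<^sub>0 \<le> ext_qnorm (X Q) (indicat_real Q)
                          \<and> ext_qnorm (X Q) (indicat_real Q) \<le> ennreal C\<^sub>0"
    and "0 < t" and "t < 1 / 2" and "Lambda_fam X t > 0"
    and "T_fam X \<eta>\<^sub>0 < \<infinity>"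
  shows "continuously_embedded (BMO_X_star X \<inter> L1_loc) (bmo_X_star_norm X) BMO bmo_norm
    \<and> continuously_embedded BMO bmo_norm (BMO_X X) (bmo_X_norm X)
    \<and> (\<forall>f\<in>BMO_X X. bmo_X_star_norm X f \<le> bmo_X_norm X f)
    \<and> BMO = BMO_X X
    \<and> BMO_X X = BMO_X_star X \<inter> L1_loc
    \<and> equivalent_seminorms_on BMO bmo_norm (bmo_X_norm X)
    \<and> equivalent_seminorms_on BMO bmo_norm (bmo_X_star_norm X)
    \<and> equivalent_seminorms_on BMO (bmo_X_norm X) (bmo_X_star_norm X)"
proof -
  obtain K :: real where K: "0 \<le> K"
    "\<And>f :: real ^ 'n \<Rightarrow> real. f \<in> BMO_X_star X \<inter> L1_loc \<Longrightarrow>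
      bmo_norm f \<le> ennreal K * bmo_X_star_norm X f"
    using bmo_norm_le_bmo_X_star_norm[OF assms(2,5,3,6,7,8)] by metis
  define L where "L = C\<^sub>n * enn2real (T_fam X \<eta>\<^sub>0)"
  have L: "0 \<le> L" "\<And>f :: real ^ 'n \<Rightarrow> real. f \<in> BMO \<Longrightarrow> bmo_X_norm X f \<le> ennreal L * bmo_norm f"
    using bmo_X_norm_le_bmo_norm[OF assms(1,2,9)] assms(1)
    by (auto simp: L_def sparse_domination_def)
  note star = bmo_X_star_norm_le_bmo_X_norm[of X]
  have 1: "BMO_X_star X \<inter> L1_loc \<subseteq> (BMO :: (real ^ 'n \<Rightarrow> real) set)"
  proof
    fix f assume f: "f \<in> BMO_X_star X \<inter> L1_loc"
    then have "ennreal K * bmo_X_star_norm X f < \<infinity>"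
      by (auto simp: BMO_X_star_def ennreal_mult_less_top)
    then show "f \<in> BMO" using f K(2)[OF f] by (auto simp: BMO_def)
  qed
  have 2: "BMO \<subseteq> BMO_X X"
  proof
    fix f :: "real ^ 'n \<Rightarrow> real" assume f: "f \<in> BMO"
    then have "ennreal L * bmo_norm f < \<infinity>"
      by (auto simp: BMO_def ennreal_mult_less_top)
    then show "f \<in> BMO_X X" using f L(2)[OF f] by (auto simp: BMO_def BMO_X_def)
  qed
  have 3: "BMO_X X \<subseteq> BMO_X_star X \<inter> L1_loc"
    using star by (auto simp: BMO_X_def BMO_X_star_def L1_loc_def intro: le_less_trans)
  have K': "bmo_norm f \<le> ennreal K * bmo_X_star_norm X f" if "f \<in> BMO" for f :: "real ^ 'n \<Rightarrow> real"
    using K(2) 2 3 that by blast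
  have eq1: "equivalent_seminorms_on BMO bmo_norm (bmo_X_norm X)"
    using K' star by (intro equivalent_seminorms_onI[OF K(1) L(1)] L(2))
      (meson order_trans mult_left_mono zero_le)
  have eq2: "equivalent_seminorms_on BMO bmo_norm (bmo_X_star_norm X)"
    using K' L(2) star by (intro equivalent_seminorms_onI[OF K(1) L(1)]) (auto intro: order_trans)
  have eq3: "equivalent_seminorms_on BMO (bmo_X_norm X) (bmo_X_star_norm X)"
  proof (rule equivalent_seminorms_onI)
    show "0 \<le> L * K" using K(1) L(1) by simp
    fix f assume f: "f \<in> (BMO :: (real ^ 'n \<Rightarrow> real) set)"
    have "bmo_X_norm X f \<le> ennreal L * (ennreal K * bmo_X_star_norm X f)"
      by (intro order_trans[OF L(2)[OF f]] mult_left_mono K'[OF f]) simp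
    then show "bmo_X_norm X f \<le> ennreal (L * K) * bmo_X_star_norm X f"
      using K(1) L(1) by (simp add: ennreal_mult mult.assoc)
    show "bmo_X_star_norm X f \<le> ennreal 1 * bmo_X_norm X f"
      using star by simp
  qed simp
  have "continuously_embedded (BMO_X_star X \<inter> L1_loc) (bmo_X_star_norm X) BMO bmo_norm"
    "continuously_embedded BMO bmo_norm (BMO_X X) (bmo_X_norm X)"
    using 1 2 K L unfolding continuously_embedded_def by blast+
  then show ?thesis
    using 1 2 3 star eq1 eq2 eq3 by blast
qed

end
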